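(* Let $\mathcal N$ be a properly infinite von Neumann algebra and let $\mathcal C\subset\mathrm{End}(\mathcal N)$ be a $C^*$ braided tensor subcategory with (unitary) braiding $\varepsilon$. Let $(\theta^A,w^A,\{m^A_i\}_{i\in I})$ and $(\theta^B,w^B,\{m^B_j\}_{j\in J})$ be two generalized Q-systems of intertwiners in $\mathcal C$. Then, for either choice of sign $\pm$, their braided product $$(\theta^A\theta^B,\; w^Aw^B,\; \{m^A_i\times_\varepsilon^{\pm}m^B_j\}_{(i,j)\in I\times J}),\qquad m^A_i\times_\varepsilon^{\pm}m^B_j:=\theta^A(\varepsilon^{\pm}_{\theta^A,\theta^B})\,m^A_i\,\theta^A(m^B_j),$$ is again a generalized Q-system of intertwiners.
   Context: $\mathrm{End}(\mathcal N)$ is the strict $C^*$ tensor category whose objects are the normal faithful unital $*$-endomorphisms of $\mathcal N$, with $\mathrm{Hom}(\rho,\sigma)=\{t\in\mathcal N: t\rho(n)=\sigma(n)t\ \forall n\in\mathcal N\}$, tensor product of objects $\rho\otimes\sigma=\rho\sigma$ (composition) and of arrows $s\otimes t=s\,\rho(t)$ for $s\in\mathrm{Hom}(\rho,\rho')$. $\langle S\rangle$ denotes the von Neumann algebra generated by $S$. A generalized Q-system in $\mathrm{End}(\mathcal N)$ is a triple $(\theta,w,\{m_i\}_{i\in I})$ with $\theta\in\mathrm{End}(\mathcal N)$, $w\in\mathrm{Hom}(\mathrm{id},\theta)$ an isometry, $\{m_i\}\subset\mathcal N$, such that (i) $p_i:=m_i^*ww^*m_i$ are mutually orthogonal projections with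 $\sum_ip_i=1$ (strongly); (ii) if $n\in\mathcal N_1:=\langle\theta(\mathcal N),\{m_i\}\rangle$ and $nw=0$ then $n=0$. It is a generalized Q-system of intertwiners if in addition $m_i\in\mathrm{Hom}(\theta,\theta^2)$ for every $i$. It is "in $\mathcal C$" if $\theta$ is an object and $w,m_i$ are arrows of $\mathcal C$. The braiding consists of unitaries $\varepsilon_{\rho,\sigma}\in\mathrm{Hom}(\rho\sigma,\sigma\rho)$, natural and tensorial (hexagon identities) in both arguments, with $\varepsilon_{\rho,\mathrm{id}}=\varepsilon_{\mathrm{id},\rho}=1$; $\varepsilon^+:=\varepsilon$ and $\varepsilon^-$ is the opposite braiding $\varepsilon^-_{\rho,\sigma}:=\varepsilon_{\sigma,\rho}^*$. *)

theory Defs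
  imports "HOL-Analysis.Analysis"
begin

section \<open>Complex Hilbert spaces and their bounded operators\<close>

text \<open>The inner product is linear in its second argument. Positive definiteness is
  contained in the last axiom.\<close>

class chilbert_space = banach +
  fixes scaleC :: "complex \<Rightarrow> 'a \<Rightarrow> 'a" (infixr "*\<^sub>C" 75)
    and cinner :: "'a \<Rightarrow> 'a \<Rightarrow> complex"
  assumes scaleC_add_right: "c *\<^sub>C (x + y) = c *\<^sub>C x + c *\<^sub>C y"
    and scaleC_add_left: "(c + d) *\<^sub>C x = c *\<^sub>C x + d *\<^sub>C x"
    and scaleC_scaleC: "c *\<^sub>C d *\<^sub>C x = (c * d) *\<^sub>C x"
    and scaleR_scaleC: "r *\<^sub>R x = complex_of_real r *\<^sub>C x"
    and cinner_commute: "cinner x y = cnj (cinner y x)"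
    and cinner_add_right: "cinner x (y + z) = cinner x y + cinner x z"
    and cinner_scaleC_right: "cinner x (c *\<^sub>C y) = c * cinner x y"
    and cinner_norm: "cinner x x = complex_of_real ((norm x)\<^sup>2)"

lemma cinner_add_left: "cinner (x + y) z = cinner x z + cinner y z"
  by (metis cinner_add_right cinner_commute complex_cnj_add)

lemma cinner_scaleC_left: "cinner (c *\<^sub>C x) y = cnj c * cinner x y"
  by (metis cinner_commute cinner_scaleC_right complex_cnj_mult)

lemma cinner_scaleR_right: "cinner x (r *\<^sub>R y) = of_real r * cinner x y"
  by (simp add: scaleR_scaleC cinner_scaleC_right)

lemma cinner_scaleR_left: "cinner (r *\<^sub>R x) y = of_real r * cinner x y"
  by (simp add: scaleR_scaleC cinner_scaleC_left)

lemma cinner_minus_right: "cinner x (- y) = - cinner x y"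
  using cinner_scaleR_right[of x "-1" y] by simp

lemma cinner_diff_right: "cinner x (y - z) = cinner x y - cinner x z"
  using cinner_add_right[of x y "- z"] by (simp add: cinner_minus_right)

lemma cinner_diff_left: "cinner (x - y) z = cinner x z - cinner y z"
  by (metis cinner_diff_right cinner_commute complex_cnj_diff)

lemma cinner_eq_zero: "cinner x x = 0 \<Longrightarrow> x = 0"
  by (simp add: cinner_norm)

lemma cinner_ext:
  fixes x y :: "'a::chilbert_space"
  assumes "\<And>z. cinner x z = cinner y z"
  shows "x = y"
proof -
  have "cinner (x - y) (x - y) = 0" using assms by (simp add: cinner_diff_left)
  then show ?thesis using cinner_eq_zero by force
qed

lemma norm_add_sq: "(norm (x + y))\<^sup>2 = (norm x)\<^sup>2 + (norm y)\<^sup>2 + 2 * Re (cinner x y)"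
proof -
  have "complex_of_real ((norm (x + y))\<^sup>2)
      = of_real ((norm x)\<^sup>2) + of_real ((norm y)\<^sup>2) + (cinner x y + cnj (cinner x y))"
    unfolding cinner_norm[symmetric] cinner_commute[of x y, symmetric]
    by (simp add: cinner_add_left cinner_add_right cinner_commute[of y x])
  then have "complex_of_real ((norm (x + y))\<^sup>2)
      = of_real ((norm x)\<^sup>2 + (norm y)\<^sup>2 + 2 * Re (cinner x y))"
    by (simp add: complex_add_cnj)
  then show ?thesis using of_real_eq_iff by blast
qed

lemma norm_scaleC: "norm (c *\<^sub>C x) = cmod c * norm x"
proof -
  have "complex_of_real ((norm (c *\<^sub>C x))\<^sup>2) = cnj c * c * of_real ((norm x)\<^sup>2)"
    unfolding cinner_norm[symmetric] by (simp add: cinner_scaleC_left cinner_scaleC_right)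
  also have "\<dots> = of_real ((cmod c * norm x)\<^sup>2)"
    by (metis complex_norm_square mult.commute of_real_mult power_mult_distrib)
  finally have "(norm (c *\<^sub>C x))\<^sup>2 = (cmod c * norm x)\<^sup>2"
    using of_real_eq_iff by blast
  then show ?thesis by (simp add: power2_eq_iff_nonneg)
qed

lemma Re_cinner_le: "Re (cinner x y) \<le> norm x * norm y"
proof -
  have "(norm (x + y))\<^sup>2 \<le> (norm x + norm y)\<^sup>2"
    by (rule power_mono) (auto simp: norm_triangle_ineq)
  then show ?thesis by (simp add: norm_add_sq power2_sum)
qed

lemma cinner_cauchy_schwarz: "cmod (cinner x y) \<le> norm x * norm y"
proof (cases "cinner x y = 0")
  case False
  define c where "c = cnj (cinner x y) / of_real (cmod (cinner x y))"
  have c: "cmod c = 1" using False by (simp add: c_def norm_divide)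
  have "cinner x (c *\<^sub>C y) = of_real (cmod (cinner x y))"
    using False by (simp add: cinner_scaleC_right c_def field_simps flip: complex_norm_square)
      (metis complex_norm_square mult.commute power2_eq_square)
  then show ?thesis using Re_cinner_le[of x "c *\<^sub>C y"] c by (simp add: norm_scaleC)
qed auto

lift_definition scaleC_op :: "complex \<Rightarrow> 'h::chilbert_space \<Rightarrow>\<^sub>L 'h \<Rightarrow> 'h \<Rightarrow>\<^sub>L 'h"
  is "\<lambda>c T x. c *\<^sub>C T x"
proof -
  fix c :: complex and T :: "'h \<Rightarrow> 'h"
  assume T: "bounded_linear T"
  have "bounded_linear (\<lambda>x::'h. c *\<^sub>C x)"
    by (rule bounded_linear_intro[where K = "cmod c"])
      (auto simp: scaleC_add_right scaleR_scaleC scaleC_scaleC norm_scaleC mult.commute)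
  from bounded_linear_compose[OF this T] show "bounded_linear (\<lambda>x. c *\<^sub>C T x)" .
qed

text \<open>Elements of \<open>'h \<Rightarrow>\<^sub>L 'h\<close> are only real linear; \<open>bounded_ops\<close> is $B(H)$.\<close>

definition bounded_ops :: "('h::chilbert_space \<Rightarrow>\<^sub>L 'h) set" where
  "bounded_ops = {T. \<forall>c x. blinfun_apply T (c *\<^sub>C x) = c *\<^sub>C T x}"

definition adj :: "('h::chilbert_space \<Rightarrow>\<^sub>L 'h) \<Rightarrow> 'h \<Rightarrow>\<^sub>L 'h" where
  "adj T = (THE S::'h \<Rightarrow>\<^sub>L 'h. \<forall>x y. cinner (S x) y = cinner x (T y))"

lemma riesz:
  fixes f :: "'h::chilbert_space \<Rightarrow> complex"
  assumes add: "\<And>x y. f (x + y) = f x + f y"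
    and sc: "\<And>c x. f (c *\<^sub>C x) = c * f x"
    and bd: "\<And>x. cmod (f x) \<le> K * norm x"
  shows "\<exists>z. \<forall>x. cinner z x = f x"
proof -
  define g where "g x = (norm x)\<^sup>2 - 2 * Re (f x)" for x
  have scR: "f (r *\<^sub>R x) = of_real r * f x" for r x
    by (simp add: scaleR_scaleC sc)
  have lb: "- K\<^sup>2 \<le> g x" for x
  proof -
    have "Re (f x) \<le> K * norm x"
      using complex_Re_le_cmod bd order_trans by blast
    moreover have "(norm x - K)\<^sup>2 = (norm x)\<^sup>2 + K\<^sup>2 - 2 * (K * norm x)"
      by (simp add: power2_diff)
    moreover have "0 \<le> (norm x - K)\<^sup>2" by simp
    ultimately show ?thesis unfolding g_def by linarith
  qed
  define d where "d = Inf (range g)"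
  have bb: "bdd_below (range g)" using lb by (auto intro!: bdd_belowI)
  have dle: "d \<le> g x" for x unfolding d_def by (rule cInf_lower) (auto simp: bb)
  have "\<exists>x. g x < d + 1 / Suc n" for n
  proof -
    have "Inf (range g) < d + 1 / Suc n" by (simp add: d_def)
    then show ?thesis using cInf_lessD[of "range g"] by blast
  qed
  then obtain X where X: "\<And>n. g (X n) < d + 1 / Suc n" by metis
  have par: "(norm (x - y))\<^sup>2 \<le> 2 * (g x + g y - 2 * d)" for x y
  proof -
    have a: "(norm (x - y))\<^sup>2 = (norm x)\<^sup>2 + (norm y)\<^sup>2 - 2 * Re (cinner x y)"
      using norm_add_sq[of x "- y"] by (simp add: cinner_minus_right)
    have b: "(norm ((1/2) *\<^sub>R (x + y)))\<^sup>2 = (norm (x + y))\<^sup>2 / 4"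
      by (simp add: power_divide)
    have c: "f ((1/2) *\<^sub>R (x + y)) = (f x + f y) / 2"
      by (simp add: scR add field_simps)
    have "d \<le> g ((1/2) *\<^sub>R (x + y))" by (rule dle)
    also have "\<dots> = ((norm x)\<^sup>2 + (norm y)\<^sup>2 + 2 * Re (cinner x y)) / 4 - Re (f x) - Re (f y)"
      unfolding g_def b c norm_add_sq by (simp add: field_simps)
    finally show ?thesis using a unfolding g_def by (simp add: field_simps)
  qed
  have "Cauchy X"
  proof (rule CauchyI)
    fix e :: real assume e: "0 < e"
    then obtain N where N: "4 / e\<^sup>2 < real N" using reals_Archimedean2 by blast
    have "norm (X m - X n) < e" if "m \<ge> N" "n \<ge> N" for m n
    proof -
      have N0: "0 < real N" using N e by (smt (verit) divide_pos_pos zero_less_power)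
      have k: "1 / Suc k < e\<^sup>2 / 4" if "k \<ge> N" for k
      proof -
        have "4 / e\<^sup>2 < Suc k" using N that by linarith
        then show ?thesis using e by (simp add: field_simps)
      qed
      have gk: "g (X k) < d + e\<^sup>2 / 4" if "k \<ge> N" for k
        using X[of k] add_strict_left_mono[OF k[OF that], of d] by (rule less_trans)
      have "(norm (X m - X n))\<^sup>2 \<le> 2 * (g (X m) + g (X n) - 2 * d)" by (rule par)
      also have "\<dots> < e\<^sup>2" using gk[OF that(1)] gk[OF that(2)] by (simp add: field_simps)
      finally show ?thesis using e by (simp add: power2_less_imp_less)
    qed
    then show "\<exists>M. \<forall>m\<ge>M. \<forall>n\<ge>M. norm (X m - X n) < e" by blast
  qed
  then obtain z where z: "X \<longlonglongrightarrow> z" using Cauchy_convergent convergent_def by blast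
  have bl: "bounded_linear f"
    by (rule bounded_linear_intro[where K = K])
      (auto simp: add scR bd mult.commute scaleR_conv_of_real)
  have "(\<lambda>n. g (X n)) \<longlonglongrightarrow> g z"
    unfolding g_def by (intro tendsto_intros z bounded_linear.tendsto[OF bl])
  moreover have "(\<lambda>n. d + 1 / Suc n) \<longlonglongrightarrow> d + 0"
    by (intro tendsto_intros LIMSEQ_Suc lim_1_over_n)
  ultimately have gz: "g z \<le> d"
    using LIMSEQ_le[of "\<lambda>n. g (X n)" "g z" "\<lambda>n. d + 1 / Suc n" "d + 0"] X less_imp_le by auto
  have Re_eq: "Re (cinner z v) = Re (f v)" for v
  proof -
    define b where "b = Re (cinner z v) - Re (f v)"
    have q: "0 \<le> t\<^sup>2 * (norm v)\<^sup>2 + 2 * t * b" for t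
    proof -
      have "g z \<le> g (z + t *\<^sub>R v)" using gz dle order_trans by blast
      then show ?thesis
        unfolding g_def norm_add_sq b_def
        by (simp add: add scR cinner_scaleR_right power_mult_distrib algebra_simps)
    qed
    have "b = 0"
    proof (rule ccontr)
      assume b: "b \<noteq> 0"
      define t where "t = - b / ((norm v)\<^sup>2 + 1)"
      have p: "(norm v)\<^sup>2 + 1 > 0" by (simp add: add_nonneg_pos)
      have "t\<^sup>2 * (norm v)\<^sup>2 + 2 * t * b \<le> t\<^sup>2 * ((norm v)\<^sup>2 + 1) + 2 * t * b"
        by (simp add: mult_left_mono)
      also have "\<dots> = - b\<^sup>2 / ((norm v)\<^sup>2 + 1)"
        unfolding t_def using p by (simp add: power2_eq_square divide_simps)
      also have "\<dots> < 0" using b p by (simp add: divide_neg_pos)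
      finally show False using q[of t] by simp
    qed
    then show ?thesis by (simp add: b_def)
  qed
  have "cinner z v = f v" for v
  proof (rule complex_eqI)
    show "Re (cinner z v) = Re (f v)" by (rule Re_eq)
    show "Im (cinner z v) = Im (f v)"
      using Re_eq[of "\<i> *\<^sub>C v"] by (simp add: cinner_scaleC_right sc)
  qed
  then show ?thesis by blast
qed

lemma adj_exists:
  fixes T :: "'h::chilbert_space \<Rightarrow>\<^sub>L 'h"
  assumes T: "T \<in> bounded_ops"
  shows "\<exists>S::'h \<Rightarrow>\<^sub>L 'h. \<forall>x y. cinner (S x) y = cinner x (T y)"
proof -
  have "\<exists>z. \<forall>y. cinner z y = cinner x (T y)" for x
  proof (rule riesz)
    show "cmod (cinner x (T y)) \<le> (norm x * norm T) * norm y" for y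
      using cinner_cauchy_schwarz[of x "T y"] mult_left_mono[OF norm_blinfun[of T y], of "norm x"]
      by (simp add: mult.assoc)
  qed (use T in \<open>auto simp: bounded_ops_def blinfun.add_right cinner_add_right cinner_scaleC_right\<close>)
  then obtain s where s: "\<And>x y. cinner (s x) y = cinner x (T y)" by metis
  have "bounded_linear s"
  proof (rule bounded_linear_intro[where K = "norm T"])
    show "s (x + y) = s x + s y" for x y
      by (rule cinner_ext) (simp add: s cinner_add_left)
    show "s (r *\<^sub>R x) = r *\<^sub>R s x" for r x
      by (rule cinner_ext) (simp add: s cinner_scaleR_left)
    show "norm (s x) \<le> norm x * norm T" for x
    proof (cases "s x = 0")
      case False
      have "(norm (s x))\<^sup>2 = cmod (cinner (s x) (s x))"
        by (simp add: cinner_norm norm_power)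
      also have "\<dots> \<le> norm x * norm (T (s x))"
        unfolding s by (rule cinner_cauchy_schwarz)
      also have "\<dots> \<le> norm x * (norm T * norm (s x))"
        by (intro mult_left_mono norm_blinfun) auto
      finally show ?thesis using False by (simp add: power2_eq_square)
    qed auto
  qed
  then have "\<forall>x y. cinner (Blinfun s x) y = cinner x (T y)"
    by (simp add: bounded_linear_Blinfun_apply s)
  then show ?thesis by blast
qed

lemma adj_unique:
  fixes S T :: "'h::chilbert_space \<Rightarrow>\<^sub>L 'h"
  assumes "\<And>x y. cinner (S x) y = cinner x (T y)"
  shows "adj T = S"
  unfolding adj_def
proof (rule the_equality)
  show "S' = S" if "\<forall>x y. cinner (S' x) y = cinner x (T y)" for S' :: "'h \<Rightarrow>\<^sub>L 'h"
    using that assms by (intro blinfun_eqI cinner_ext) simp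
qed (use assms in blast)

lemma cinner_adj:
  assumes "T \<in> bounded_ops"
  shows "cinner (adj T x) y = cinner x (T y)"
  using adj_exists[OF assms] adj_unique by metis


section \<open>Von Neumann algebras\<close>

definition von_neumann_algebra :: "('h::chilbert_space \<Rightarrow>\<^sub>L 'h) set \<Rightarrow> bool" where
  "von_neumann_algebra N \<longleftrightarrow>
     N \<subseteq> bounded_ops \<and>
     id_blinfun \<in> N \<and>
     (\<forall>a\<in>N. \<forall>b\<in>N. a + b \<in> N \<and> a o\<^sub>L b \<in> N) \<and>
     (\<forall>c. \<forall>a\<in>N. scaleC_op c a \<in> N) \<and>
     (\<forall>a\<in>N. adj a \<in> N) \<and>
     closedin strong_operator_topology N"

definition vN_generated :: "('h::chilbert_space \<Rightarrow>\<^sub>L 'h) set \<Rightarrow> ('h \<Rightarrow>\<^sub>L 'h) set" where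
  "vN_generated S = \<Inter>{M. von_neumann_algebra M \<and> S \<subseteq> M}"

definition is_projection :: "('h::chilbert_space \<Rightarrow>\<^sub>L 'h) \<Rightarrow> bool" where
  "is_projection p \<longleftrightarrow> p \<in> bounded_ops \<and> adj p = p \<and> p o\<^sub>L p = p"

definition vN_center :: "('h::chilbert_space \<Rightarrow>\<^sub>L 'h) set \<Rightarrow> ('h \<Rightarrow>\<^sub>L 'h) set" where
  "vN_center N = {z \<in> N. \<forall>n\<in>N. z o\<^sub>L n = n o\<^sub>L z}"

definition murray_von_neumann_equiv ::
    "('h::chilbert_space \<Rightarrow>\<^sub>L 'h) set \<Rightarrow> ('h \<Rightarrow>\<^sub>L 'h) \<Rightarrow> ('h \<Rightarrow>\<^sub>L 'h) \<Rightarrow> bool" where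
  "murray_von_neumann_equiv N p q \<longleftrightarrow> (\<exists>v\<in>N. adj v o\<^sub>L v = p \<and> v o\<^sub>L adj v = q)"

definition infinite_projection ::
    "('h::chilbert_space \<Rightarrow>\<^sub>L 'h) set \<Rightarrow> ('h \<Rightarrow>\<^sub>L 'h) \<Rightarrow> bool" where
  "infinite_projection N p \<longleftrightarrow>
     (\<exists>q\<in>N. is_projection q \<and> p o\<^sub>L q = q \<and> q \<noteq> p \<and> murray_von_neumann_equiv N p q)"

definition properly_infinite :: "('h::chilbert_space \<Rightarrow>\<^sub>L 'h) set \<Rightarrow> bool" where
  "properly_infinite N \<longleftrightarrow>
     (\<forall>z\<in>vN_center N. is_projection z \<and> z \<noteq> 0 \<longrightarrow> infinite_projection N z)"

definition positive_op :: "('h::chilbert_space \<Rightarrow>\<^sub>L 'h) \<Rightarrow> bool" where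
  "positive_op T \<longleftrightarrow> T \<in> bounded_ops \<and> (\<forall>x. cinner x (T x) \<in> \<real>\<^sub>\<ge>\<^sub>0)"

definition op_le :: "('h::chilbert_space \<Rightarrow>\<^sub>L 'h) \<Rightarrow> ('h \<Rightarrow>\<^sub>L 'h) \<Rightarrow> bool" where
  "op_le S T \<longleftrightarrow> positive_op (T - S)"

definition self_adjoint_part :: "('h::chilbert_space \<Rightarrow>\<^sub>L 'h) set \<Rightarrow> ('h \<Rightarrow>\<^sub>L 'h) set" where
  "self_adjoint_part N = {a \<in> N. adj a = a}"

definition is_lub_in ::
    "('h::chilbert_space \<Rightarrow>\<^sub>L 'h) set \<Rightarrow> ('h \<Rightarrow>\<^sub>L 'h) set \<Rightarrow> ('h \<Rightarrow>\<^sub>L 'h) \<Rightarrow> bool" where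
  "is_lub_in N D a \<longleftrightarrow>
     a \<in> self_adjoint_part N \<and> (\<forall>d\<in>D. op_le d a) \<and>
     (\<forall>b\<in>self_adjoint_part N. (\<forall>d\<in>D. op_le d b) \<longrightarrow> op_le a b)"

text \<open>Normality: suprema of upward directed sets of self-adjoint elements are preserved. Since
  bounded increasing nets in a von Neumann algebra have suprema, asking for the existence of a
  supremum is the same as asking for boundedness.\<close>

definition normal_map ::
    "('h::chilbert_space \<Rightarrow>\<^sub>L 'h) set \<Rightarrow> (('h \<Rightarrow>\<^sub>L 'h) \<Rightarrow> ('h \<Rightarrow>\<^sub>L 'h)) \<Rightarrow> bool" where
  "normal_map N \<rho> \<longleftrightarrow>
     (\<forall>D a. D \<noteq> {} \<and> D \<subseteq> self_adjoint_part N \<and>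
        (\<forall>d\<in>D. \<forall>e\<in>D. \<exists>f\<in>D. op_le d f \<and> op_le e f) \<and> is_lub_in N D a \<longrightarrow>
        is_lub_in N (\<rho> ` D) (\<rho> a))"


section \<open>The category of endomorphisms\<close>

text \<open>Endomorphisms of \<open>N\<close> are maps defined on \<open>N\<close> only, hence extensional functions: equality
  of objects is then equality of maps on \<open>N\<close>.\<close>

type_synonym 'h endo = "('h \<Rightarrow>\<^sub>L 'h) \<Rightarrow> ('h \<Rightarrow>\<^sub>L 'h)"

definition End :: "('h::chilbert_space \<Rightarrow>\<^sub>L 'h) set \<Rightarrow> 'h endo set" where
  "End N = {\<rho> \<in> N \<rightarrow>\<^sub>E N.
     (\<forall>a\<in>N. \<forall>b\<in>N. \<rho> (a + b) = \<rho> a + \<rho> b \<and> \<rho> (a o\<^sub>L b) = \<rho> a o\<^sub>L \<rho> b) \<and>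
     (\<forall>c. \<forall>a\<in>N. \<rho> (scaleC_op c a) = scaleC_op c (\<rho> a)) \<and>
     (\<forall>a\<in>N. \<rho> (adj a) = adj (\<rho> a)) \<and>
     \<rho> id_blinfun = id_blinfun \<and>
     inj_on \<rho> N \<and>
     normal_map N \<rho>}"

definition id_endo :: "('h::chilbert_space \<Rightarrow>\<^sub>L 'h) set \<Rightarrow> 'h endo" where
  "id_endo N = (\<lambda>n\<in>N. n)"

definition Hom :: "('h::chilbert_space \<Rightarrow>\<^sub>L 'h) set \<Rightarrow> 'h endo \<Rightarrow> 'h endo \<Rightarrow> ('h \<Rightarrow>\<^sub>L 'h) set" where
  "Hom N \<rho> \<sigma> = {t \<in> N. \<forall>n\<in>N. t o\<^sub>L \<rho> n = \<sigma> n o\<^sub>L t}"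

text \<open>\<open>arrow_tensor \<rho> s t\<close> is $s \otimes t$, where \<open>\<rho>\<close> is the source of \<open>s\<close>. The tensor product of
  objects is \<^term>\<open>compose N \<rho> \<sigma>\<close>.\<close>

definition arrow_tensor ::
    "'h::chilbert_space endo \<Rightarrow> ('h \<Rightarrow>\<^sub>L 'h) \<Rightarrow> ('h \<Rightarrow>\<^sub>L 'h) \<Rightarrow> ('h \<Rightarrow>\<^sub>L 'h)" where
  "arrow_tensor \<rho> s t = s o\<^sub>L \<rho> t"

record 'op subcat =
  obj :: "('op \<Rightarrow> 'op) set"
  arr :: "('op \<Rightarrow> 'op) \<Rightarrow> ('op \<Rightarrow> 'op) \<Rightarrow> 'op set"

text \<open>Subcategories need not be full; \<open>arr C \<rho> \<sigma>\<close> is the space of arrows \<open>\<rho> \<rightarrow> \<sigma>\<close> of \<open>C\<close> and is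
  only meaningful for objects \<open>\<rho>\<close>, \<open>\<sigma>\<close>.\<close>

definition C_star_tensor_subcategory ::
    "('h::chilbert_space \<Rightarrow>\<^sub>L 'h) set \<Rightarrow> ('h \<Rightarrow>\<^sub>L 'h) subcat \<Rightarrow> bool" where
  "C_star_tensor_subcategory N C \<longleftrightarrow>
     obj C \<subseteq> End N \<and>
     id_endo N \<in> obj C \<and>
     (\<forall>\<rho>\<in>obj C. \<forall>\<sigma>\<in>obj C. compose N \<rho> \<sigma> \<in> obj C) \<and>
     (\<forall>\<rho>\<in>obj C. id_blinfun \<in> arr C \<rho> \<rho>) \<and>
     (\<forall>\<rho>\<in>obj C. \<forall>\<sigma>\<in>obj C.
        arr C \<rho> \<sigma> \<subseteq> Hom N \<rho> \<sigma> \<and>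
        0 \<in> arr C \<rho> \<sigma> \<and>
        (\<forall>s\<in>arr C \<rho> \<sigma>. \<forall>t\<in>arr C \<rho> \<sigma>. s + t \<in> arr C \<rho> \<sigma>) \<and>
        (\<forall>c. \<forall>t\<in>arr C \<rho> \<sigma>. scaleC_op c t \<in> arr C \<rho> \<sigma>) \<and>
        (\<forall>t\<in>arr C \<rho> \<sigma>. adj t \<in> arr C \<sigma> \<rho>) \<and>
        closed (arr C \<rho> \<sigma>)) \<and>
     (\<forall>\<rho>\<in>obj C. \<forall>\<sigma>\<in>obj C. \<forall>\<tau>\<in>obj C. \<forall>t\<in>arr C \<rho> \<sigma>. \<forall>s\<in>arr C \<sigma> \<tau>. s o\<^sub>L t \<in> arr C \<rho> \<tau>) \<and>
     (\<forall>\<rho>\<in>obj C. \<forall>\<rho>'\<in>obj C. \<forall>\<sigma>\<in>obj C. \<forall>\<sigma>'\<in>obj C. \<forall>s\<in>arr C \<rho> \<rho>'. \<forall>t\<in>arr C \<sigma> \<sigma>'.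
        arrow_tensor \<rho> s t \<in> arr C (compose N \<rho> \<sigma>) (compose N \<rho>' \<sigma>'))"

definition unitary_braiding ::
    "('h::chilbert_space \<Rightarrow>\<^sub>L 'h) set \<Rightarrow> ('h \<Rightarrow>\<^sub>L 'h) subcat \<Rightarrow> ('h endo \<Rightarrow> 'h endo \<Rightarrow> ('h \<Rightarrow>\<^sub>L 'h)) \<Rightarrow> bool"
  where
  "unitary_braiding N C \<epsilon> \<longleftrightarrow>
     (\<forall>\<rho>\<in>obj C. \<forall>\<sigma>\<in>obj C.
        \<epsilon> \<rho> \<sigma> \<in> arr C (compose N \<rho> \<sigma>) (compose N \<sigma> \<rho>) \<and>
        adj (\<epsilon> \<rho> \<sigma>) o\<^sub>L \<epsilon> \<rho> \<sigma> = id_blinfun \<and> \<epsilon> \<rho> \<sigma> o\<^sub>L adj (\<epsilon> \<rho> \<sigma>) = id_blinfun) \<and>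
     (\<forall>\<rho>\<in>obj C. \<forall>\<rho>'\<in>obj C. \<forall>\<sigma>\<in>obj C. \<forall>\<sigma>'\<in>obj C. \<forall>s\<in>arr C \<rho> \<rho>'. \<forall>t\<in>arr C \<sigma> \<sigma>'.
        \<epsilon> \<rho>' \<sigma>' o\<^sub>L arrow_tensor \<rho> s t = arrow_tensor \<sigma> t s o\<^sub>L \<epsilon> \<rho> \<sigma>) \<and>
     (\<forall>\<rho>\<in>obj C. \<forall>\<sigma>\<in>obj C. \<forall>\<tau>\<in>obj C.
        \<epsilon> (compose N \<rho> \<sigma>) \<tau> =
          arrow_tensor (compose N \<rho> \<tau>) (\<epsilon> \<rho> \<tau>) id_blinfun o\<^sub>L arrow_tensor \<rho> id_blinfun (\<epsilon> \<sigma> \<tau>) \<and>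
        \<epsilon> \<rho> (compose N \<sigma> \<tau>) =
          arrow_tensor \<sigma> id_blinfun (\<epsilon> \<rho> \<tau>) o\<^sub>L arrow_tensor (compose N \<rho> \<sigma>) (\<epsilon> \<rho> \<sigma>) id_blinfun) \<and>
     (\<forall>\<rho>\<in>obj C. \<epsilon> \<rho> (id_endo N) = id_blinfun \<and> \<epsilon> (id_endo N) \<rho> = id_blinfun)"

datatype braiding_sign = Plus | Minus

primrec signed_braiding ::
    "braiding_sign \<Rightarrow> ('h::chilbert_space endo \<Rightarrow> 'h endo \<Rightarrow> ('h \<Rightarrow>\<^sub>L 'h)) \<Rightarrow>
      ('h endo \<Rightarrow> 'h endo \<Rightarrow> ('h \<Rightarrow>\<^sub>L 'h))" where
  "signed_braiding Plus \<epsilon> = \<epsilon>"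
| "signed_braiding Minus \<epsilon> = (\<lambda>\<rho> \<sigma>. adj (\<epsilon> \<sigma> \<rho>))"


section \<open>Generalized Q-systems\<close>

text \<open>The family $\{m_i\}_{i \in I}$ is given by a function \<open>m\<close> and the index set \<open>I\<close>; the strongly
  convergent sum over \<open>I\<close> is the limit of the net of finite partial sums.\<close>

definition generalized_Q_system ::
    "('h::chilbert_space \<Rightarrow>\<^sub>L 'h) set \<Rightarrow> 'h endo \<Rightarrow> ('h \<Rightarrow>\<^sub>L 'h) \<Rightarrow> ('i \<Rightarrow> ('h \<Rightarrow>\<^sub>L 'h)) \<Rightarrow> 'i set \<Rightarrow> bool"
  where
  "generalized_Q_system N \<theta> w m I \<longleftrightarrow>
     \<theta> \<in> End N \<and> w \<in> Hom N (id_endo N) \<theta> \<and> adj w o\<^sub>L w = id_blinfun \<and> m ` I \<subseteq> N \<and>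
     (let p = (\<lambda>i. adj (m i) o\<^sub>L w o\<^sub>L adj w o\<^sub>L m i) in
        (\<forall>i\<in>I. is_projection (p i)) \<and>
        (\<forall>i\<in>I. \<forall>j\<in>I. i \<noteq> j \<longrightarrow> p i o\<^sub>L p j = 0) \<and>
        (\<forall>x. ((\<lambda>i. p i x) has_sum x) I)) \<and>
     (\<forall>n\<in>vN_generated (\<theta> ` N \<union> m ` I). n o\<^sub>L w = 0 \<longrightarrow> n = 0)"

definition generalized_Q_system_of_intertwiners ::
    "('h::chilbert_space \<Rightarrow>\<^sub>L 'h) set \<Rightarrow> 'h endo \<Rightarrow> ('h \<Rightarrow>\<^sub>L 'h) \<Rightarrow> ('i \<Rightarrow> ('h \<Rightarrow>\<^sub>L 'h)) \<Rightarrow> 'i set \<Rightarrow> bool"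
  where
  "generalized_Q_system_of_intertwiners N \<theta> w m I \<longleftrightarrow>
     generalized_Q_system N \<theta> w m I \<and> (\<forall>i\<in>I. m i \<in> Hom N \<theta> (compose N \<theta> \<theta>))"

definition Q_system_in ::
    "('h::chilbert_space \<Rightarrow>\<^sub>L 'h) set \<Rightarrow> ('h \<Rightarrow>\<^sub>L 'h) subcat \<Rightarrow> 'h endo \<Rightarrow> ('h \<Rightarrow>\<^sub>L 'h) \<Rightarrow>
      ('i \<Rightarrow> ('h \<Rightarrow>\<^sub>L 'h)) \<Rightarrow> 'i set \<Rightarrow> bool" where
  "Q_system_in N C \<theta> w m I \<longleftrightarrow>
     \<theta> \<in> obj C \<and> w \<in> arr C (id_endo N) \<theta> \<and> (\<forall>i\<in>I. m i \<in> arr C \<theta> (compose N \<theta> \<theta>))"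

text \<open>The braided product $m^A \times_\varepsilon m^B$ for a given braiding (\<open>\<epsilon>\<close> or its opposite).\<close>

definition braided_product ::
    "('h::chilbert_space endo \<Rightarrow> 'h endo \<Rightarrow> ('h \<Rightarrow>\<^sub>L 'h)) \<Rightarrow> 'h endo \<Rightarrow> 'h endo \<Rightarrow>
      ('h \<Rightarrow>\<^sub>L 'h) \<Rightarrow> ('h \<Rightarrow>\<^sub>L 'h) \<Rightarrow> ('h \<Rightarrow>\<^sub>L 'h)" where
  "braided_product \<epsilon> \<theta>A \<theta>B mA mB = \<theta>A (\<epsilon> \<theta>A \<theta>B) o\<^sub>L mA o\<^sub>L \<theta>A mB"

end

theory Submission
  imports Defs
begin

text \<open>Write $u = \varepsilon^{\pm}_{\theta^A,\theta^B}$, $M_{ij} = \theta^A(u)\, m^A_i\, \theta^A(m^B_j)$,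
  $W = w^A w^B$, and put $a_i = {w^A}^* m^A_i$, $b_j = {w^B}^* m^B_j$. The opposite of a unitary braiding
  is again a unitary braiding (\<open>opposite_braiding\<close>), so that both signs are covered by one argument,
  based on naturality, the hexagon identities and $\varepsilon_{\rho,\mathrm{id}} =
  \varepsilon_{\mathrm{id},\rho} = 1$. That the $M_{ij}$ and $W$ are intertwiners in the category is
  bookkeeping with the tensor product of arrows. There are two genuine points.

  The projections. Pulling ${w^B}^*$ through $u$ removes the braiding and gives $W^* M_{ij} =
  \theta^A(b_j)\, a_i$ (\<open>compress_braided_product\<close>). Because $m^A_i$ is an intertwiner, $a_i$ lies in
  $\mathrm{Hom}(\theta^A,\theta^A)$ and commutes with $\theta^A(\mathcal N)$. Hence
  $M_{ij}^* W W^* M_{ij} = \theta^A(q_j)\, p_i$ is a product of commuting projections, where $p_i$ and $q_j$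
  are the projections of the two given systems. The $\theta^A(q_j)$ still add up to $1$ strongly because
  $\theta^A$ is normal (\<open>End_projection_partition\<close>), and products of two commuting resolutions of the
  identity form a resolution of the identity (\<open>projection_partition_product\<close>).

  The separating property. Let $\mathcal A = \langle\theta^A(\mathcal N), m^A_i\rangle$,
  $\mathcal B = \langle\theta^B(\mathcal N), m^B_j\rangle$, and let $\mathcal M$ be generated by
  $\theta^A\theta^B(\mathcal N)$ and the $M_{ij}$. All three factors of $M_{ij}$ lie in $\mathcal A$, so
  $\mathcal M \subseteq \mathcal A$. The hexagon identities and naturality give $u M_{ij} u^* =
  \theta^B(m^A_i)\,\theta^B(u^*)\, m^B_j$ (\<open>conjugate_braided_product\<close>), so also
  $u \mathcal M u^* \subseteq \mathcal B$. Now let $n \in \mathcal M$ with $n w^A w^B = 0$. Since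
  $u w^A = \theta^B(w^A)$, the element $u n u^*\,\theta^B(w^A) = u n w^A$ of $\mathcal B$ is annihilated by
  $w^B$, and therefore vanishes. So $n w^A = 0$ with $n \in \mathcal A$, and $n = 0$
  (\<open>braided_product_separating\<close>).\<close>

section \<open>Bounded operators\<close>

lemma oL_assoc: "(a o\<^sub>L b) o\<^sub>L c = a o\<^sub>L (b o\<^sub>L c)"
  by (rule blinfun_eqI) simp

lemma oL_id [simp]: "a o\<^sub>L id_blinfun = a" "id_blinfun o\<^sub>L a = a"
  by (rule blinfun_eqI, simp)+

lemma oL_zero [simp]: "a o\<^sub>L 0 = 0" "0 o\<^sub>L a = 0"
  by (rule blinfun_eqI, simp add: blinfun.zero_right)+

lemma sum_blinfun_apply: "blinfun_apply (\<Sum>k\<in>F. P k) x = (\<Sum>k\<in>F. blinfun_apply (P k) x)"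
  by (induction F rule: infinite_finite_induct) (auto simp: blinfun.add_left)

lemma cinner_zero [simp]: "cinner x 0 = 0" "cinner 0 x = 0"
  using cinner_diff_right[of x x x] cinner_diff_left[of x x x] by simp_all

lemma cinner_sum_right: "cinner x (\<Sum>k\<in>F. f k) = (\<Sum>k\<in>F. cinner x (f k))"
  by (induction F rule: infinite_finite_induct) (auto simp: cinner_add_right)

lemma bounded_linear_cinner_right: "bounded_linear (cinner x)"
  by (rule bounded_linear_intro[where K = "norm x"])
    (auto simp: cinner_add_right cinner_scaleR_right scaleR_conv_of_real cinner_cauchy_schwarz
      mult.commute[of "norm _" "norm x"])

lemma cinner_ext_right:
  fixes x y :: "'a::chilbert_space"
  assumes "\<And>z. cinner z x = cinner z y"
  shows "x = y"
  by (rule cinner_ext) (metis assms cinner_commute)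

lemma bounded_ops_oL: "a \<in> bounded_ops \<Longrightarrow> b \<in> bounded_ops \<Longrightarrow> a o\<^sub>L b \<in> bounded_ops"
  by (simp add: bounded_ops_def)

lemma bounded_ops_id [simp]: "id_blinfun \<in> bounded_ops"
  by (simp add: bounded_ops_def)

lemma bounded_ops_zero [simp]: "(0 :: 'h::chilbert_space \<Rightarrow>\<^sub>L 'h) \<in> bounded_ops"
proof -
  have "c *\<^sub>C (0::'h) = 0" for c
    by (rule cinner_ext_right) (simp add: cinner_scaleC_right)
  then show ?thesis by (simp add: bounded_ops_def)
qed

lemma bounded_ops_add: "a \<in> bounded_ops \<Longrightarrow> b \<in> bounded_ops \<Longrightarrow> a + b \<in> bounded_ops"
  by (simp add: bounded_ops_def blinfun.add_left scaleC_add_right)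

lemma bounded_ops_diff:
  assumes "a \<in> bounded_ops" "b \<in> bounded_ops"
  shows "a - b \<in> bounded_ops"
proof -
  have "c *\<^sub>C (x - y) = c *\<^sub>C x - c *\<^sub>C y" for c and x y :: 'a
    by (rule cinner_ext_right) (simp add: cinner_scaleC_right cinner_diff_right right_diff_distrib)
  then show ?thesis using assms by (simp add: bounded_ops_def blinfun.diff_left)
qed

lemma cinner_adj_right:
  assumes "T \<in> bounded_ops"
  shows "cinner y (adj T x) = cinner (T y) x"
  by (metis assms cinner_adj cinner_commute)

lemma bounded_ops_adj:
  assumes "T \<in> bounded_ops"
  shows "adj T \<in> bounded_ops"
proof -
  have "adj T (c *\<^sub>C x) = c *\<^sub>C adj T x" for c x
    by (rule cinner_ext) (simp add: assms cinner_adj cinner_scaleC_left)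
  then show ?thesis by (simp add: bounded_ops_def)
qed

lemma adj_adj: "T \<in> bounded_ops \<Longrightarrow> adj (adj T) = T"
  by (rule adj_unique) (simp add: cinner_adj_right)

lemma adj_oL: "a \<in> bounded_ops \<Longrightarrow> b \<in> bounded_ops \<Longrightarrow> adj (a o\<^sub>L b) = adj b o\<^sub>L adj a"
  by (rule adj_unique) (simp add: cinner_adj)

lemma adj_add: "a \<in> bounded_ops \<Longrightarrow> b \<in> bounded_ops \<Longrightarrow> adj (a + b) = adj a + adj b"
  by (rule adj_unique) (simp add: cinner_adj blinfun.add_left cinner_add_left cinner_add_right)

lemma adj_id [simp]: "adj id_blinfun = id_blinfun"
  by (rule adj_unique) simp

lemma scaleC_op_oL: "scaleC_op c a o\<^sub>L b = scaleC_op c (a o\<^sub>L b)"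
  by (rule blinfun_eqI) (simp add: scaleC_op.rep_eq)

lemma oL_scaleC_op: "a \<in> bounded_ops \<Longrightarrow> a o\<^sub>L scaleC_op c b = scaleC_op c (a o\<^sub>L b)"
  by (rule blinfun_eqI) (simp add: scaleC_op.rep_eq bounded_ops_def)

lemma oL_add_left: "(a + b) o\<^sub>L c = (a o\<^sub>L c) + (b o\<^sub>L c)"
  by (rule blinfun_eqI) (simp add: blinfun.add_left)

lemma oL_add_right: "c o\<^sub>L (a + b) = (c o\<^sub>L a) + (c o\<^sub>L b)"
  by (rule blinfun_eqI) (simp add: blinfun.add_left blinfun.add_right)

section \<open>Resolutions of the identity into orthogonal projections\<close>

definition projection_partition :: "('k \<Rightarrow> ('h::chilbert_space \<Rightarrow>\<^sub>L 'h)) \<Rightarrow> 'k set \<Rightarrow> bool" where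
  "projection_partition P K \<longleftrightarrow>
     (\<forall>k\<in>K. is_projection (P k)) \<and> (\<forall>k\<in>K. \<forall>l\<in>K. k \<noteq> l \<longrightarrow> P k o\<^sub>L P l = 0) \<and>
     (\<forall>x. ((\<lambda>k. P k x) has_sum x) K)"

lemma norm_sum_orthogonal:
  fixes f :: "'k \<Rightarrow> 'h::chilbert_space"
  assumes "finite F" and "\<And>k l. k \<in> F \<Longrightarrow> l \<in> F \<Longrightarrow> k \<noteq> l \<Longrightarrow> cinner (f k) (f l) = 0"
  shows "(norm (\<Sum>k\<in>F. f k))\<^sup>2 = (\<Sum>k\<in>F. (norm (f k))\<^sup>2)"
  using assms
proof (induction F rule: finite_induct)
  case (insert k F)
  have "cinner (f k) (\<Sum>l\<in>F. f l) = 0"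
    using insert.hyps insert.prems by (auto simp: cinner_sum_right intro!: sum.neutral)
  then show ?case using insert by (simp add: norm_add_sq)
qed simp

text \<open>By Pythagoras, the squared distance of two nested partial sums is the difference of the
  corresponding partial sums of $\lVert f_k\rVert^2$, which increase to a finite supremum. So the net of
  partial sums is Cauchy.\<close>

lemma orthogonal_summable:
  fixes f :: "'k \<Rightarrow> 'h::chilbert_space"
  assumes orth: "\<And>k l. k \<in> K \<Longrightarrow> l \<in> K \<Longrightarrow> k \<noteq> l \<Longrightarrow> cinner (f k) (f l) = 0"
    and bound: "\<And>F. finite F \<Longrightarrow> F \<subseteq> K \<Longrightarrow> (\<Sum>k\<in>F. (norm (f k))\<^sup>2) \<le> B"
  shows "f summable_on K"
proof -
  define s where "s F = (\<Sum>k\<in>F. (norm (f k))\<^sup>2)" for F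
  define S where "S = Sup (s ` {F. finite F \<and> F \<subseteq> K})"
  have bdd: "bdd_above (s ` {F. finite F \<and> F \<subseteq> K})"
    using bound by (auto simp: s_def intro!: bdd_aboveI)
  have le: "s F \<le> S" if "finite F" "F \<subseteq> K" for F
    unfolding S_def using that by (intro cSup_upper bdd) auto
  have "\<exists>P. eventually P (finite_subsets_at_top K) \<and>
      (\<forall>F G. P F \<and> P G \<longrightarrow> dist (sum f F) (sum f G) < e)" if e: "0 < e" for e
  proof -
    have "S - (e/2)\<^sup>2 < S" using e by simp
    then obtain F0 where F0: "finite F0" "F0 \<subseteq> K" "S - (e/2)\<^sup>2 < s F0"
      using less_cSup_iff[OF _ bdd, of "S - (e/2)\<^sup>2"] unfolding S_def by auto
    define P where "P F \<longleftrightarrow> finite F \<and> F0 \<subseteq> F \<and> F \<subseteq> K" for F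
    have near: "dist (sum f F) (sum f F0) < e/2" if "P F" for F
    proof -
      have fin: "finite F" "F0 \<subseteq> F" "F \<subseteq> K" using that by (auto simp: P_def)
      have "(dist (sum f F) (sum f F0))\<^sup>2 = (norm (sum f (F - F0)))\<^sup>2"
        unfolding dist_norm using fin F0 by (simp add: sum_diff)
      also have "\<dots> = s (F - F0)"
        unfolding s_def using fin orth by (intro norm_sum_orthogonal) (auto simp: subset_eq)
      also have "\<dots> = s F - s F0" unfolding s_def using fin F0 by (simp add: sum_diff)
      also have "\<dots> < (e/2)\<^sup>2" using le[of F] fin F0(3) by simp
      finally show ?thesis by (rule power_less_imp_less_base) (use e in simp)
    qed
    have "dist (sum f F) (sum f G) < e" if "P F" "P G" for F G
      using near[OF that(1)] near[OF that(2)] dist_triangle2[of "sum f F" "sum f G" "sum f F0"]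
      by linarith
    moreover have "eventually P (finite_subsets_at_top K)"
      unfolding eventually_finite_subsets_at_top P_def using F0 by blast
    ultimately show ?thesis by blast
  qed
  then have "cauchy_filter (filtermap (sum f) (finite_subsets_at_top K))"
    by (simp add: cauchy_filter_metric_filtermap)
  moreover have "complete (UNIV::'h set)"
    by (meson Cauchy_convergent UNIV_I complete_def convergent_def)
  ultimately obtain L where "(sum f \<longlongrightarrow> L) (finite_subsets_at_top K)"
    using complete_uniform[where S=UNIV] by (force simp add: filterlim_def)
  then show ?thesis using summable_on_def has_sum_def by blast
qed

lemma projection_cinner:
  assumes "is_projection p"
  shows "cinner (p x) y = cinner x (p y)"
  using assms cinner_adj[of p x y] by (simp add: is_projection_def)

lemma projection_idem:
  assumes "is_projection p"
  shows "p (p x) = p x"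
  using assms blinfun_apply_blinfun_compose[of p p x] by (simp add: is_projection_def)

lemma projection_zero [simp]: "is_projection 0"
proof -
  have "adj (0::'a \<Rightarrow>\<^sub>L 'a) = 0" by (rule adj_unique) simp
  then show ?thesis by (simp add: is_projection_def)
qed

lemma projection_add:
  assumes p: "is_projection p" and q: "is_projection q" and "p o\<^sub>L q = 0"
  shows "is_projection (p + q)"
proof -
  have "adj (p o\<^sub>L q) = q o\<^sub>L p" using p q by (simp add: adj_oL is_projection_def)
  then have "q o\<^sub>L p = 0"
    using assms(3) projection_zero by (metis is_projection_def)
  then show ?thesis
    using assms by (simp add: is_projection_def bounded_ops_add adj_add oL_add_left oL_add_right)
qed

lemma projection_sum:
  assumes "finite F" and "\<And>k. k \<in> F \<Longrightarrow> is_projection (P k)"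
    and "\<And>k l. k \<in> F \<Longrightarrow> l \<in> F \<Longrightarrow> k \<noteq> l \<Longrightarrow> P k o\<^sub>L P l = 0"
  shows "is_projection (\<Sum>k\<in>F. P k)"
  using assms
proof (induction F rule: finite_induct)
  case (insert k F)
  have "P k o\<^sub>L (\<Sum>l\<in>F. P l) = (\<Sum>l\<in>F. P k o\<^sub>L P l)"
    by (rule bounded_bilinear.sum_right[OF bounded_bilinear_blinfun_compose])
  also have "\<dots> = 0" using insert by (intro sum.neutral) auto
  finally show ?case using insert by (auto intro!: projection_add)
qed simp

lemma projection_cinner_self:
  assumes "is_projection p"
  shows "cinner x (p x) = of_real ((norm (p x))\<^sup>2)"
  by (metis assms cinner_norm projection_cinner projection_idem)

lemma projection_positive:
  assumes "is_projection p"
  shows "positive_op p"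
proof -
  have "cinner x (p x) \<in> \<real>\<^sub>\<ge>\<^sub>0" for x
    unfolding projection_cinner_self[OF assms] nonneg_Reals_of_real_iff by simp
  then show ?thesis using assms by (simp add: positive_op_def is_projection_def)
qed

lemma projection_norm_le:
  assumes "is_projection p"
  shows "norm (p x) \<le> norm x"
proof (cases "p x = 0")
  case False
  have "(norm (p x))\<^sup>2 = cmod (cinner x (p x))"
    using assms by (simp add: projection_cinner_self norm_power)
  also have "\<dots> \<le> norm x * norm (p x)" by (rule cinner_cauchy_schwarz)
  finally show ?thesis using False by (simp add: power2_eq_square)
qed simp

lemma projection_norm_diff:
  assumes "is_projection p"
  shows "(norm (x - p x))\<^sup>2 = (norm x)\<^sup>2 - Re (cinner x (p x))"
  using norm_add_sq[of x "- p x"]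
  by (simp add: cinner_minus_right projection_cinner_self[OF assms])

lemma orthogonal_projections_summable:
  assumes proj: "\<And>k. k \<in> K \<Longrightarrow> is_projection (P k)"
    and orth: "\<And>k l. k \<in> K \<Longrightarrow> l \<in> K \<Longrightarrow> k \<noteq> l \<Longrightarrow> P k o\<^sub>L P l = 0"
  shows "(\<lambda>k. P k x) summable_on K"
proof (rule orthogonal_summable)
  have o: "cinner (P k x) (P l x) = 0" if "k \<in> K" "l \<in> K" "k \<noteq> l" for k l
    using orth[OF that] blinfun_apply_blinfun_compose[of "P k" "P l" x] that
    by (simp add: projection_cinner[OF proj])
  then show "k \<in> K \<Longrightarrow> l \<in> K \<Longrightarrow> k \<noteq> l \<Longrightarrow> cinner (P k x) (P l x) = 0" for k l .
  show "(\<Sum>k\<in>F. (norm (P k x))\<^sup>2) \<le> (norm x)\<^sup>2" if F: "finite F" "F \<subseteq> K" for F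
  proof -
    have "is_projection (\<Sum>k\<in>F. P k)"
      using F proj orth by (intro projection_sum) (auto simp: subset_eq)
    then have "norm (\<Sum>k\<in>F. P k x) \<le> norm x"
      using projection_norm_le sum_blinfun_apply by metis
    moreover have "(norm (\<Sum>k\<in>F. P k x))\<^sup>2 = (\<Sum>k\<in>F. (norm (P k x))\<^sup>2)"
      using F o by (intro norm_sum_orthogonal) (auto simp: subset_eq)
    ultimately show ?thesis by (metis norm_ge_zero power_mono)
  qed
qed

text \<open>The products are again mutually orthogonal projections, so the double family is summable by
  Bessel's inequality. Its sum may then be computed as an iterated sum, first over \<open>J\<close>.\<close>

lemma projection_partition_product:
  assumes p: "projection_partition p I" and q: "projection_partition q J"
    and comm: "\<And>i j. i \<in> I \<Longrightarrow> j \<in> J \<Longrightarrow> p i o\<^sub>L q j = q j o\<^sub>L p i"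
  shows "projection_partition (\<lambda>(i, j). q j o\<^sub>L p i) (I \<times> J)"
proof -
  define r where "r = (\<lambda>(i, j). q j o\<^sub>L p i)"
  have proj: "is_projection (r k)" if k: "k \<in> I \<times> J" for k
  proof -
    obtain i j where ij: "k = (i, j)" "i \<in> I" "j \<in> J" using k by blast
    have "is_projection (p i)" "is_projection (q j)"
      using p q ij by (auto simp: projection_partition_def)
    moreover have "(q j o\<^sub>L p i) o\<^sub>L (q j o\<^sub>L p i) = (q j o\<^sub>L q j) o\<^sub>L (p i o\<^sub>L p i)"
      using comm[OF ij(2,3)] by (metis oL_assoc)
    ultimately show ?thesis
      using comm[OF ij(2,3)] ij(1) by (simp add: r_def is_projection_def bounded_ops_oL adj_oL)
  qed
  have orth: "r k o\<^sub>L r l = 0" if kl: "k \<in> I \<times> J" "l \<in> I \<times> J" "k \<noteq> l" for k l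
  proof -
    obtain i j where ij: "k = (i, j)" "i \<in> I" "j \<in> J" using kl by blast
    obtain i' j' where ij': "l = (i', j')" "i' \<in> I" "j' \<in> J" using kl by blast
    have "r k o\<^sub>L r l = (q j o\<^sub>L q j') o\<^sub>L (p i o\<^sub>L p i')"
      using comm[OF ij(2) ij'(3)] ij(1) ij'(1) by (simp add: r_def) (metis oL_assoc)
    moreover have "q j o\<^sub>L q j' = 0 \<or> p i o\<^sub>L p i' = 0"
      using p q kl(3) ij ij' by (auto simp: projection_partition_def)
    ultimately show ?thesis by auto
  qed
  have "((\<lambda>k. r k x) has_sum x) (I \<times> J)" for x
  proof -
    have "(\<lambda>k. r k x) summable_on I \<times> J"
      using proj orth by (rule orthogonal_projections_summable)
    then obtain s where s: "((\<lambda>k. r k x) has_sum s) (I \<times> J)"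
      by (auto simp: summable_on_def)
    have "((\<lambda>i. p i x) has_sum s) I"
      using s
    proof (rule has_sum_SigmaD)
      show "((\<lambda>j. r (i, j) x) has_sum p i x) J" if "i \<in> I" for i
        using q by (simp add: r_def projection_partition_def)
    qed
    moreover have "((\<lambda>i. p i x) has_sum x) I" using p by (simp add: projection_partition_def)
    ultimately have "s = x" by (rule has_sum_unique)
    then show ?thesis using s by simp
  qed
  then show ?thesis
    using proj orth unfolding projection_partition_def r_def[symmetric] by blast
qed

section \<open>Von Neumann algebras and normal endomorphisms\<close>

text \<open>The strong operator topology is the topology of pointwise convergence, so that a set closed for
  it contains the limits of its pointwise convergent nets.\<close>

lemma strong_limit_closed:
  fixes T :: "'k \<Rightarrow> ('a::real_normed_vector \<Rightarrow>\<^sub>L 'b::real_normed_vector)" and Q :: "'a \<Rightarrow>\<^sub>L 'b"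
  assumes "closedin strong_operator_topology M" and "F \<noteq> bot"
    and "eventually (\<lambda>k. T k \<in> M) F" and lim: "\<And>x. ((\<lambda>k. T k x) \<longlongrightarrow> Q x) F"
  shows "Q \<in> M"
proof -
  have "limitin (product_topology (\<lambda>_. euclidean) UNIV) (\<lambda>k. blinfun_apply (T k)) (blinfun_apply Q) F"
    using lim by (subst limitin_componentwise) auto
  then have fl: "limitin euclidean (\<lambda>k. blinfun_apply (T k)) (blinfun_apply Q) F"
    by (simp add: euclidean_product_topology)
  have "limitin strong_operator_topology T Q F"
    unfolding limitin_def
  proof (intro conjI allI impI)
    show "Q \<in> topspace strong_operator_topology" by (simp add: strong_operator_topology_topspace)
    fix U assume "openin strong_operator_topology U \<and> Q \<in> U"
    then obtain V where V: "open V" "U = blinfun_apply -` V" "blinfun_apply Q \<in> V"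
      by (auto simp: strong_operator_topology_def openin_pullback_topology)
    then show "\<forall>\<^sub>F k in F. T k \<in> U" using fl unfolding limitin_def by auto
  qed
  then show ?thesis using assms by (auto intro: limitin_closedin)
qed

lemma
  assumes "von_neumann_algebra N"
  shows vN_bounded: "a \<in> N \<Longrightarrow> a \<in> bounded_ops"
    and vN_id: "id_blinfun \<in> N"
    and vN_add: "a \<in> N \<Longrightarrow> b \<in> N \<Longrightarrow> a + b \<in> N"
    and vN_oL: "a \<in> N \<Longrightarrow> b \<in> N \<Longrightarrow> a o\<^sub>L b \<in> N"
    and vN_scaleC_op: "a \<in> N \<Longrightarrow> scaleC_op c a \<in> N"
    and vN_adj: "a \<in> N \<Longrightarrow> adj a \<in> N"
    and vN_closed: "closedin strong_operator_topology N"
  using assms by (auto simp: von_neumann_algebra_def)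

lemma vN_zero:
  fixes N :: "('h::chilbert_space \<Rightarrow>\<^sub>L 'h) set"
  assumes "von_neumann_algebra N"
  shows "0 \<in> N"
proof -
  have "scaleC_op 0 id_blinfun = (0 :: 'h \<Rightarrow>\<^sub>L 'h)"
    using scaleR_scaleC[of 0] by (intro blinfun_eqI) (simp add: scaleC_op.rep_eq)
  then show ?thesis using vN_scaleC_op[OF assms vN_id[OF assms], of 0] by simp
qed

lemma vN_sum:
  assumes "von_neumann_algebra N" "\<And>k. k \<in> F \<Longrightarrow> P k \<in> N"
  shows "(\<Sum>k\<in>F. P k) \<in> N"
  using assms(2) by (induction F rule: infinite_finite_induct) (auto simp: vN_zero vN_add assms(1))

lemma vN_generated_minimal: "von_neumann_algebra M \<Longrightarrow> S \<subseteq> M \<Longrightarrow> vN_generated S \<subseteq> M"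
  by (auto simp: vN_generated_def)

lemma vN_generated_in: "x \<in> S \<Longrightarrow> x \<in> vN_generated S"
  by (auto simp: vN_generated_def)

lemma von_neumann_algebra_generated:
  assumes "von_neumann_algebra N" "S \<subseteq> N"
  shows "von_neumann_algebra (vN_generated S)"
proof -
  have "closedin strong_operator_topology (vN_generated S)"
    unfolding vN_generated_def using assms by (intro closedin_Inter) (auto simp: vN_closed)
  moreover have "vN_generated S \<subseteq> bounded_ops"
    using vN_generated_minimal[OF assms] vN_bounded[OF assms(1)] by blast
  ultimately show ?thesis
    unfolding von_neumann_algebra_def
    by (auto simp: vN_generated_def intro: vN_id vN_add vN_oL vN_scaleC_op vN_adj)
qed

text \<open>This is the algebra $u^* M u$, written as a preimage under the strongly continuous map
  $n \mapsto u n u^*$. In this form, $u \langle S\rangle u^* \subseteq M$ can be checked on the generators \<open>S\<close>.\<close>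

lemma von_neumann_algebra_conjugate:
  assumes M: "von_neumann_algebra M"
    and u: "u \<in> bounded_ops" "adj u o\<^sub>L u = id_blinfun" "u o\<^sub>L adj u = id_blinfun"
  shows "von_neumann_algebra {n. u o\<^sub>L n o\<^sub>L adj u \<in> M}"
proof -
  let ?c = "\<lambda>n. u o\<^sub>L n o\<^sub>L adj u"
  have bdd: "n \<in> bounded_ops" if "?c n \<in> M" for n
  proof -
    have "n = adj u o\<^sub>L ?c n o\<^sub>L u" by (metis oL_assoc oL_id u(2))
    then show ?thesis using u(1) vN_bounded[OF M that] by (metis bounded_ops_adj bounded_ops_oL)
  qed
  have mult: "?c (a o\<^sub>L b) = ?c a o\<^sub>L ?c b" for a b
    by (metis oL_assoc oL_id(2) u(2))
  have adj: "?c (adj n) = adj (?c n)" if "n \<in> bounded_ops" for n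
    using that u(1) by (simp add: adj_oL bounded_ops_oL bounded_ops_adj adj_adj oL_assoc)
  have sc: "?c (scaleC_op c n) = scaleC_op c (?c n)" for c n
    using u(1) by (simp add: oL_scaleC_op scaleC_op_oL)
  have "continuous_map strong_operator_topology strong_operator_topology ?c"
    unfolding continuous_on_strong_operator_topo_iff_coordinatewise
  proof
    fix x
    have "continuous_map strong_operator_topology euclidean (blinfun_apply u \<circ> (\<lambda>n. blinfun_apply n (adj u x)))"
      by (rule continuous_map_compose[OF strong_operator_topology_continuous_evaluation])
        (simp add: blinfun.continuous_on continuous_on_id)
    then show "continuous_map strong_operator_topology euclidean (\<lambda>n. blinfun_apply (?c n) x)"
      by (simp add: comp_def)
  qed
  from closedin_continuous_map_preimage[OF this vN_closed[OF M]]
  have "closedin strong_operator_topology {n. ?c n \<in> M}"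
    by (simp add: strong_operator_topology_topspace)
  then show ?thesis
    unfolding von_neumann_algebra_def
    using bdd M by (auto simp: mult adj sc u(3) oL_add_left oL_add_right
        intro: vN_id vN_add vN_oL vN_scaleC_op vN_adj)
qed

lemma
  assumes "\<rho> \<in> End N"
  shows End_in: "a \<in> N \<Longrightarrow> \<rho> a \<in> N"
    and End_add: "a \<in> N \<Longrightarrow> b \<in> N \<Longrightarrow> \<rho> (a + b) = \<rho> a + \<rho> b"
    and End_oL: "a \<in> N \<Longrightarrow> b \<in> N \<Longrightarrow> \<rho> (a o\<^sub>L b) = \<rho> a o\<^sub>L \<rho> b"
    and End_adj: "a \<in> N \<Longrightarrow> \<rho> (adj a) = adj (\<rho> a)"
    and End_id: "\<rho> id_blinfun = id_blinfun"
    and End_normal: "normal_map N \<rho>"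
  using assms by (auto simp: End_def)

lemma End_zero:
  assumes "\<rho> \<in> End N" "von_neumann_algebra N"
  shows "\<rho> 0 = 0"
  using End_add[OF assms(1) vN_zero[OF assms(2)] vN_zero[OF assms(2)]] by simp

lemma End_sum:
  assumes "\<rho> \<in> End N" "von_neumann_algebra N" "\<And>k. k \<in> F \<Longrightarrow> P k \<in> N"
  shows "\<rho> (\<Sum>k\<in>F. P k) = (\<Sum>k\<in>F. \<rho> (P k))"
  using assms(3)
  by (induction F rule: infinite_finite_induct)
    (auto simp: End_zero[OF assms(1,2)] End_add[OF assms(1)] vN_sum[OF assms(2)])

lemma End_projection:
  assumes "\<rho> \<in> End N" "von_neumann_algebra N" "p \<in> N" "is_projection p"
  shows "is_projection (\<rho> p)"
  using assms End_in[OF assms(1,3)] vN_bounded[OF assms(2)]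
  by (metis End_adj End_oL is_projection_def)

text \<open>Together with the next lemma, this translates strong convergence of a sum of orthogonal projections
  to $1$ into the order of the algebra, which is all that normal maps are known to respect.\<close>

lemma projection_partition_is_lub:
  assumes N: "von_neumann_algebra N" and q: "projection_partition q J" and qN: "q ` J \<subseteq> N"
  shows "is_lub_in N ((\<lambda>F. \<Sum>j\<in>F. q j) ` {F. finite F \<and> F \<subseteq> J}) id_blinfun"
proof -
  have proj: "is_projection (\<Sum>j\<in>F. q j)" if "finite F" "F \<subseteq> J" for F
    using that q by (intro projection_sum) (auto simp: projection_partition_def subset_eq)
  have "op_le (\<Sum>j\<in>F. q j) id_blinfun" if "finite F" "F \<subseteq> J" for F
  proof -
    define p where "p = (\<Sum>j\<in>F. q j)"
    have p: "is_projection p" using proj[OF that] by (simp add: p_def)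
    have "cinner x ((id_blinfun - p) x) \<in> \<real>\<^sub>\<ge>\<^sub>0" for x
    proof -
      have "cinner x ((id_blinfun - p) x) = of_real ((norm x)\<^sup>2 - (norm (p x))\<^sup>2)"
        using p by (simp add: blinfun.diff_left cinner_diff_right cinner_norm projection_cinner_self)
      moreover have "(norm (p x))\<^sup>2 \<le> (norm x)\<^sup>2"
        using projection_norm_le[OF p] by (simp add: power_mono)
      ultimately show ?thesis by (simp only: nonneg_Reals_of_real_iff)
    qed
    then show ?thesis
      using p by (simp add: op_le_def positive_op_def bounded_ops_diff is_projection_def flip: p_def)
  qed
  moreover have "op_le id_blinfun b"
    if b: "b \<in> self_adjoint_part N"
      and ub: "\<And>F. finite F \<Longrightarrow> F \<subseteq> J \<Longrightarrow> op_le (\<Sum>j\<in>F. q j) b" for b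
  proof -
    have "cinner x ((b - id_blinfun) x) \<in> \<real>\<^sub>\<ge>\<^sub>0" for x
    proof -
      have "((\<lambda>F. \<Sum>j\<in>F. q j x) \<longlongrightarrow> x) (finite_subsets_at_top J)"
        using q by (simp add: projection_partition_def has_sum_def)
      then have "((\<lambda>F. cinner x (b x) - cinner x (\<Sum>j\<in>F. q j x)) \<longlongrightarrow>
          cinner x (b x) - cinner x x) (finite_subsets_at_top J)"
        by (intro tendsto_intros bounded_linear.tendsto[OF bounded_linear_cinner_right])
      moreover have "cinner x (b x) - cinner x (\<Sum>j\<in>F. q j x) \<in> \<real>\<^sub>\<ge>\<^sub>0" if "finite F \<and> F \<subseteq> J" for F
        using ub[of F] that
        by (simp add: op_le_def positive_op_def blinfun.diff_left cinner_diff_right sum_blinfun_apply)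
      then have "\<forall>\<^sub>F F in finite_subsets_at_top J.
          cinner x (b x) - cinner x (\<Sum>j\<in>F. q j x) \<in> \<real>\<^sub>\<ge>\<^sub>0"
        by (intro eventually_finite_subsets_at_top_weakI) auto
      ultimately have "cinner x (b x) - cinner x x \<in> \<real>\<^sub>\<ge>\<^sub>0"
        by (rule Lim_in_closed_set[OF closed_nonneg_Reals_complex, rotated 2]) simp
      then show ?thesis by (simp add: blinfun.diff_left cinner_diff_right)
    qed
    then show ?thesis
      using b vN_bounded[OF N]
      by (auto simp: op_le_def positive_op_def self_adjoint_part_def intro: bounded_ops_diff)
  qed
  ultimately show ?thesis
    unfolding is_lub_in_def self_adjoint_part_def using vN_id[OF N] by auto
qed

text \<open>The partial sums always converge strongly to some self-adjoint \<open>T\<close>, which lies in the algebra and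
  is an upper bound of them. If $1$ is the least upper bound, then $1 \le T$, and the identity
  $\lVert x - s x\rVert^2 = \lVert x\rVert^2 - \langle x, s x\rangle$ for the partial sums \<open>s\<close> forces
  $T x = x$.\<close>

lemma is_lub_imp_projection_partition:
  assumes N: "von_neumann_algebra N" and qN: "q ` J \<subseteq> N"
    and proj: "\<And>j. j \<in> J \<Longrightarrow> is_projection (q j)"
    and orth: "\<And>j k. j \<in> J \<Longrightarrow> k \<in> J \<Longrightarrow> j \<noteq> k \<Longrightarrow> q j o\<^sub>L q k = 0"
    and lub: "is_lub_in N ((\<lambda>F. \<Sum>j\<in>F. q j) ` {F. finite F \<and> F \<subseteq> J}) id_blinfun"
  shows "projection_partition q J"
proof -
  let ?F = "finite_subsets_at_top J"
  define s where "s F = (\<Sum>j\<in>F. q j)" for F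
  have s_proj: "is_projection (s F)" if "finite F" "F \<subseteq> J" for F
    unfolding s_def using that proj orth by (intro projection_sum) (auto simp: subset_eq)
  define Q where "Q x = (\<Sum>\<^sub>\<infinity>j\<in>J. q j x)" for x
  have lim: "((\<lambda>F. s F x) \<longlongrightarrow> Q x) ?F" for x
    using has_sum_infsum[OF orthogonal_projections_summable[OF proj orth]]
    by (simp add: Q_def has_sum_def s_def sum_blinfun_apply)
  have ev: "\<forall>\<^sub>F F in ?F. R F" if "\<And>F. finite F \<Longrightarrow> F \<subseteq> J \<Longrightarrow> R F" for R
    using that by (intro eventually_finite_subsets_at_top_weakI) auto
  have "bounded_linear Q"
  proof (rule bounded_linear_intro[where K = 1])
    show "Q (x + y) = Q x + Q y" for x y
      using tendsto_unique[OF _ lim[of "x + y"]] tendsto_add[OF lim[of x] lim[of y]]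
      by (simp add: blinfun.add_right)
    show "Q (r *\<^sub>R x) = r *\<^sub>R Q x" for r x
      using tendsto_unique[OF _ lim[of "r *\<^sub>R x"]] tendsto_scaleR[OF tendsto_const lim[of x], of r]
      by (simp add: blinfun.scaleR_right)
    show "norm (Q x) \<le> norm x * 1" for x
      using tendsto_upperbound[OF tendsto_norm[OF lim] ev[of "\<lambda>F. norm (s F x) \<le> norm x"]]
        s_proj projection_norm_le by auto
  qed
  then obtain T where T: "Q = blinfun_apply T"
    using bounded_linear_Blinfun_apply by metis
  have "T \<in> N"
    using vN_closed[OF N] finite_subsets_at_top_neq_bot[of J] _ lim[unfolded T]
  proof (rule strong_limit_closed)
    show "\<forall>\<^sub>F F in ?F. s F \<in> N"
      using qN by (intro ev) (auto simp: s_def subset_eq intro!: vN_sum[OF N])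
  qed
  have T_bd: "T \<in> bounded_ops" using vN_bounded[OF N \<open>T \<in> N\<close>] .
  have lim_right: "((\<lambda>F. cinner y (s F x)) \<longlongrightarrow> cinner y (T x)) ?F" for x y
    using bounded_linear.tendsto[OF bounded_linear_cinner_right lim] by (simp add: T)
  have "adj T = T"
  proof (rule adj_unique)
    fix x y
    have "((\<lambda>F. cnj (cinner y (s F x))) \<longlongrightarrow> cnj (cinner y (T x))) ?F"
      by (intro tendsto_intros lim_right)
    then have l: "((\<lambda>F. cinner (s F x) y) \<longlongrightarrow> cinner (T x) y) ?F"
      by (simp flip: cinner_commute)
    moreover have "\<forall>\<^sub>F F in ?F. cinner (s F x) y = cinner x (s F y)"
      using s_proj projection_cinner by (intro ev) auto
    ultimately have "((\<lambda>F. cinner x (s F y)) \<longlongrightarrow> cinner (T x) y) ?F"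
      by (rule Lim_transform_eventually)
    then show "cinner (T x) y = cinner x (T y)"
      using lim_right tendsto_unique finite_subsets_at_top_neq_bot by metis
  qed
  then have "T \<in> self_adjoint_part N" using \<open>T \<in> N\<close> by (simp add: self_adjoint_part_def)
  moreover have "op_le (s F) T" if F: "finite F" "F \<subseteq> J" for F
  proof -
    have "cinner x ((T - s F) x) \<in> \<real>\<^sub>\<ge>\<^sub>0" for x
    proof -
      have "((\<lambda>G. cinner x (s G x) - cinner x (s F x)) \<longlongrightarrow> cinner x (T x) - cinner x (s F x)) ?F"
        by (intro tendsto_intros lim_right)
      moreover have "\<forall>\<^sub>F G in ?F. cinner x (s G x) - cinner x (s F x) \<in> \<real>\<^sub>\<ge>\<^sub>0"
        unfolding eventually_finite_subsets_at_top
      proof (intro exI[of _ F] conjI allI impI F)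
        fix G assume G: "finite G \<and> F \<subseteq> G \<and> G \<subseteq> J"
        then have "cinner x (s G x) - cinner x (s F x) = cinner x (s (G - F) x)"
          by (simp add: s_def sum_diff blinfun.diff_left cinner_diff_right)
        then show "cinner x (s G x) - cinner x (s F x) \<in> \<real>\<^sub>\<ge>\<^sub>0"
          using projection_positive[OF s_proj[of "G - F"]] G by (auto simp: positive_op_def)
      qed
      ultimately have "cinner x (T x) - cinner x (s F x) \<in> \<real>\<^sub>\<ge>\<^sub>0"
        by (rule Lim_in_closed_set[OF closed_nonneg_Reals_complex, rotated 2]) simp
      then show ?thesis by (simp add: blinfun.diff_left cinner_diff_right)
    qed
    moreover have "s F \<in> bounded_ops" using s_proj[OF F] by (simp add: is_projection_def)
    ultimately show ?thesis using T_bd by (simp add: op_le_def positive_op_def bounded_ops_diff)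
  qed
  ultimately have ge: "op_le id_blinfun T"
    using lub unfolding is_lub_in_def s_def[symmetric] by blast
  have "T x = x" for x
  proof -
    have "cinner x (T x) - of_real ((norm x)\<^sup>2) \<in> \<real>\<^sub>\<ge>\<^sub>0"
      using ge by (simp add: op_le_def positive_op_def blinfun.diff_left cinner_diff_right cinner_norm)
    then have ge_x: "(norm x)\<^sup>2 \<le> Re (cinner x (T x))"
      by (simp add: complex_nonneg_Reals_iff)
    have lim_s: "((\<lambda>F. s F x) \<longlongrightarrow> T x) ?F" using lim by (simp add: T)
    have "((\<lambda>F. Re (cinner x (s F x))) \<longlongrightarrow> Re (cinner x (T x))) ?F"
      by (intro tendsto_intros lim_right)
    moreover have "((\<lambda>F. (norm (x - s F x))\<^sup>2) \<longlongrightarrow> (norm (x - T x))\<^sup>2) ?F"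
      by (intro tendsto_intros lim_s)
    moreover have "\<forall>\<^sub>F F in ?F. (norm (x - s F x))\<^sup>2 = (norm x)\<^sup>2 - Re (cinner x (s F x))"
      using projection_norm_diff[OF s_proj] by (intro ev)
    ultimately have "((\<lambda>F. (norm x)\<^sup>2 - Re (cinner x (s F x))) \<longlongrightarrow> (norm (x - T x))\<^sup>2) ?F"
      using Lim_transform_eventually by fast
    moreover have "((\<lambda>F. (norm x)\<^sup>2 - Re (cinner x (s F x))) \<longlongrightarrow> (norm x)\<^sup>2 - Re (cinner x (T x))) ?F"
      by (intro tendsto_intros lim_right)
    ultimately have "(norm (x - T x))\<^sup>2 = (norm x)\<^sup>2 - Re (cinner x (T x))"
      using tendsto_unique[OF finite_subsets_at_top_neq_bot] by blast
    then have "(norm (x - T x))\<^sup>2 \<le> 0" using ge_x by simp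
    then show ?thesis by simp
  qed
  then have "((\<lambda>j. q j x) has_sum x) J" for x
    using lim[of x] by (simp add: has_sum_def s_def sum_blinfun_apply T)
  then show ?thesis using proj orth by (simp add: projection_partition_def)
qed

text \<open>A normal endomorphism maps the directed set of finite partial sums, whose supremum is $1$, to the
  directed set of partial sums of the images.\<close>

lemma End_projection_partition:
  assumes N: "von_neumann_algebra N" and \<rho>: "\<rho> \<in> End N"
    and q: "projection_partition q J" and qN: "q ` J \<subseteq> N"
  shows "projection_partition (\<lambda>j. \<rho> (q j)) J"
proof (rule is_lub_imp_projection_partition[OF N])
  have in_N: "q j \<in> N" if "j \<in> J" for j using qN that by blast
  show "(\<lambda>j. \<rho> (q j)) ` J \<subseteq> N" using in_N \<rho> by (auto intro: End_in)
  show "is_projection (\<rho> (q j))" if "j \<in> J" for j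
    using q that in_N by (auto simp: projection_partition_def intro!: End_projection[OF \<rho> N])
  show "\<rho> (q j) o\<^sub>L \<rho> (q k) = 0" if "j \<in> J" "k \<in> J" "j \<noteq> k" for j k
    using q that in_N by (simp add: projection_partition_def End_zero[OF \<rho> N] flip: End_oL[OF \<rho>])
  let ?\<F> = "{F. finite F \<and> F \<subseteq> J}"
  let ?D = "(\<lambda>F. \<Sum>j\<in>F. q j) ` ?\<F>"
  have lub: "is_lub_in N ?D id_blinfun" by (rule projection_partition_is_lub[OF N q qN])
  have proj: "is_projection (\<Sum>j\<in>F. q j)" if "finite F" "F \<subseteq> J" for F
    using that q by (intro projection_sum) (auto simp: projection_partition_def subset_eq)
  have mono: "op_le (\<Sum>j\<in>F. q j) (\<Sum>j\<in>G. q j)" if FG: "finite G" "F \<subseteq> G" "G \<subseteq> J" for F G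
  proof -
    have "(\<Sum>j\<in>G. q j) - (\<Sum>j\<in>F. q j) = (\<Sum>j\<in>G - F. q j)"
      using FG by (simp add: sum_diff)
    moreover have "is_projection (\<Sum>j\<in>G - F. q j)" using FG by (intro proj) auto
    ultimately show ?thesis by (simp add: op_le_def projection_positive)
  qed
  have "?D \<subseteq> self_adjoint_part N"
    using proj in_N by (auto simp: self_adjoint_part_def is_projection_def intro!: vN_sum[OF N])
  moreover have "\<exists>f\<in>?D. op_le d f \<and> op_le e f" if de: "d \<in> ?D" "e \<in> ?D" for d e
  proof -
    obtain F G where "finite F" "F \<subseteq> J" "d = (\<Sum>j\<in>F. q j)" "finite G" "G \<subseteq> J" "e = (\<Sum>j\<in>G. q j)"
      using de by auto
    then show ?thesis by (intro bexI[of _ "\<Sum>j\<in>F \<union> G. q j"]) (auto intro!: mono)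
  qed
  ultimately have "is_lub_in N (\<rho> ` ?D) (\<rho> id_blinfun)"
    using lub by (intro End_normal[OF \<rho>, unfolded normal_map_def, rule_format] conjI ballI) auto
  moreover have "\<rho> ` ?D = (\<lambda>F. \<Sum>j\<in>F. \<rho> (q j)) ` ?\<F>"
    unfolding image_image using in_N by (intro image_cong End_sum[OF \<rho> N]) auto
  ultimately show "is_lub_in N ((\<lambda>F. \<Sum>j\<in>F. \<rho> (q j)) ` ?\<F>) id_blinfun"
    by (simp add: End_id[OF \<rho>])
qed

section \<open>Braided categories of endomorphisms\<close>

locale braided_endomorphisms =
  fixes N :: "('h::chilbert_space \<Rightarrow>\<^sub>L 'h) set"
    and C :: "('h \<Rightarrow>\<^sub>L 'h) subcat"
    and \<epsilon> :: "'h endo \<Rightarrow> 'h endo \<Rightarrow> ('h \<Rightarrow>\<^sub>L 'h)"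
  assumes vN: "von_neumann_algebra N"
    and subcategory: "C_star_tensor_subcategory N C"
    and braiding: "unitary_braiding N C \<epsilon>"
begin

lemma
  shows obj_End: "\<rho> \<in> obj C \<Longrightarrow> \<rho> \<in> End N"
    and obj_id: "id_endo N \<in> obj C"
    and obj_compose: "\<rho> \<in> obj C \<Longrightarrow> \<sigma> \<in> obj C \<Longrightarrow> compose N \<rho> \<sigma> \<in> obj C"
    and arr_id: "\<rho> \<in> obj C \<Longrightarrow> id_blinfun \<in> arr C \<rho> \<rho>"
    and arr_Hom: "\<rho> \<in> obj C \<Longrightarrow> \<sigma> \<in> obj C \<Longrightarrow> t \<in> arr C \<rho> \<sigma> \<Longrightarrow> t \<in> Hom N \<rho> \<sigma>"
    and arr_adj: "\<rho> \<in> obj C \<Longrightarrow> \<sigma> \<in> obj C \<Longrightarrow> t \<in> arr C \<rho> \<sigma> \<Longrightarrow> adj t \<in> arr C \<sigma> \<rho>"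
    and arr_comp: "\<rho> \<in> obj C \<Longrightarrow> \<sigma> \<in> obj C \<Longrightarrow> \<tau> \<in> obj C \<Longrightarrow>
      t \<in> arr C \<rho> \<sigma> \<Longrightarrow> s \<in> arr C \<sigma> \<tau> \<Longrightarrow> s o\<^sub>L t \<in> arr C \<rho> \<tau>"
    and arr_tensor: "\<rho> \<in> obj C \<Longrightarrow> \<rho>' \<in> obj C \<Longrightarrow> \<sigma> \<in> obj C \<Longrightarrow> \<sigma>' \<in> obj C \<Longrightarrow>
      s \<in> arr C \<rho> \<rho>' \<Longrightarrow> t \<in> arr C \<sigma> \<sigma>' \<Longrightarrow>
      s o\<^sub>L \<rho> t \<in> arr C (compose N \<rho> \<sigma>) (compose N \<rho>' \<sigma>')"
  using subcategory unfolding C_star_tensor_subcategory_def arrow_tensor_def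
  by (simp_all add: subset_iff)

lemma arr_in:
  assumes "\<rho> \<in> obj C" "\<sigma> \<in> obj C" "t \<in> arr C \<rho> \<sigma>"
  shows "t \<in> N"
  using arr_Hom[OF assms] by (simp add: Hom_def)

lemma arr_intertwines:
  assumes "\<rho> \<in> obj C" "\<sigma> \<in> obj C" "t \<in> arr C \<rho> \<sigma>" "n \<in> N"
  shows "t o\<^sub>L \<rho> n = \<sigma> n o\<^sub>L t"
  using arr_Hom[OF assms(1-3)] assms(4) by (simp add: Hom_def)

lemmas in_bounded = vN_bounded[OF vN]

lemma obj_restrict: "\<rho> \<in> obj C \<Longrightarrow> \<rho> \<in> extensional N"
  using obj_End by (auto simp: End_def PiE_def)

lemma compose_id_endo:
  assumes "\<rho> \<in> obj C"
  shows "compose N \<rho> (id_endo N) = \<rho>" "compose N (id_endo N) \<rho> = \<rho>"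
proof -
  show "compose N \<rho> (id_endo N) = \<rho>"
    using obj_restrict[OF assms] by (intro ext) (auto simp: compose_def id_endo_def extensional_def restrict_def)
  show "compose N (id_endo N) \<rho> = \<rho>"
    using obj_restrict[OF assms] End_in[OF obj_End[OF assms]]
    by (intro ext) (auto simp: compose_def id_endo_def extensional_def restrict_def)
qed

lemma compose_assoc_obj:
  assumes "\<rho> \<in> obj C" "\<sigma> \<in> obj C" "\<tau> \<in> obj C"
  shows "compose N (compose N \<rho> \<sigma>) \<tau> = compose N \<rho> (compose N \<sigma> \<tau>)"
  using End_in[OF obj_End[OF assms(3)]] by (intro ext) (auto simp: compose_def)

lemma
  assumes "\<rho> \<in> obj C" "\<sigma> \<in> obj C"
  shows braiding_arr: "\<epsilon> \<rho> \<sigma> \<in> arr C (compose N \<rho> \<sigma>) (compose N \<sigma> \<rho>)"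
    and braiding_unitary: "adj (\<epsilon> \<rho> \<sigma>) o\<^sub>L \<epsilon> \<rho> \<sigma> = id_blinfun" "\<epsilon> \<rho> \<sigma> o\<^sub>L adj (\<epsilon> \<rho> \<sigma>) = id_blinfun"
  using assms braiding unfolding unitary_braiding_def by blast+

lemma braiding_in:
  assumes "\<rho> \<in> obj C" "\<sigma> \<in> obj C"
  shows "\<epsilon> \<rho> \<sigma> \<in> N"
  using assms by (intro arr_in[OF _ _ braiding_arr]) (auto intro: obj_compose)

lemma braiding_intertwines:
  assumes "\<rho> \<in> obj C" "\<sigma> \<in> obj C" "n \<in> N"
  shows "\<epsilon> \<rho> \<sigma> o\<^sub>L \<rho> (\<sigma> n) = \<sigma> (\<rho> n) o\<^sub>L \<epsilon> \<rho> \<sigma>"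
  using arr_intertwines[OF _ _ braiding_arr[OF assms(1,2)] assms(3)] assms
  by (simp add: obj_compose compose_eq)

lemma braiding_natural:
  assumes "\<rho> \<in> obj C" "\<rho>' \<in> obj C" "\<sigma> \<in> obj C" "\<sigma>' \<in> obj C" "s \<in> arr C \<rho> \<rho>'" "t \<in> arr C \<sigma> \<sigma>'"
  shows "\<epsilon> \<rho>' \<sigma>' o\<^sub>L (s o\<^sub>L \<rho> t) = (t o\<^sub>L \<sigma> s) o\<^sub>L \<epsilon> \<rho> \<sigma>"
  using assms braiding unfolding unitary_braiding_def arrow_tensor_def by blast

lemma braiding_natural_left:
  assumes "\<rho> \<in> obj C" "\<rho>' \<in> obj C" "\<sigma> \<in> obj C" "s \<in> arr C \<rho> \<rho>'"
  shows "\<epsilon> \<rho>' \<sigma> o\<^sub>L s = \<sigma> s o\<^sub>L \<epsilon> \<rho> \<sigma>"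
  using braiding_natural[OF assms(1-3) assms(3,4) arr_id[OF assms(3)]]
  by (simp add: End_id[OF obj_End] assms)

lemma braiding_natural_right:
  assumes "\<rho> \<in> obj C" "\<sigma> \<in> obj C" "\<sigma>' \<in> obj C" "t \<in> arr C \<sigma> \<sigma>'"
  shows "\<epsilon> \<rho> \<sigma>' o\<^sub>L \<rho> t = t o\<^sub>L \<epsilon> \<rho> \<sigma>"
  using braiding_natural[OF assms(1,1) assms(2,3) arr_id[OF assms(1)] assms(4)]
  by (simp add: End_id[OF obj_End] assms)

lemma braiding_hexagon:
  assumes "\<rho> \<in> obj C" "\<sigma> \<in> obj C" "\<tau> \<in> obj C"
  shows "\<epsilon> (compose N \<rho> \<sigma>) \<tau> = \<epsilon> \<rho> \<tau> o\<^sub>L \<rho> (\<epsilon> \<sigma> \<tau>)"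
    and "\<epsilon> \<rho> (compose N \<sigma> \<tau>) = \<sigma> (\<epsilon> \<rho> \<tau>) o\<^sub>L \<epsilon> \<rho> \<sigma>"
proof -
  have "\<epsilon> (compose N \<rho> \<sigma>) \<tau> =
          arrow_tensor (compose N \<rho> \<tau>) (\<epsilon> \<rho> \<tau>) id_blinfun o\<^sub>L arrow_tensor \<rho> id_blinfun (\<epsilon> \<sigma> \<tau>) \<and>
        \<epsilon> \<rho> (compose N \<sigma> \<tau>) =
          arrow_tensor \<sigma> id_blinfun (\<epsilon> \<rho> \<tau>) o\<^sub>L arrow_tensor (compose N \<rho> \<sigma>) (\<epsilon> \<rho> \<sigma>) id_blinfun"
    using assms braiding unfolding unitary_braiding_def by blast
  then show "\<epsilon> (compose N \<rho> \<sigma>) \<tau> = \<epsilon> \<rho> \<tau> o\<^sub>L \<rho> (\<epsilon> \<sigma> \<tau>)"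
    and "\<epsilon> \<rho> (compose N \<sigma> \<tau>) = \<sigma> (\<epsilon> \<rho> \<tau>) o\<^sub>L \<epsilon> \<rho> \<sigma>"
    by (simp_all add: arrow_tensor_def End_id[OF obj_End] obj_compose assms)
qed

lemma braiding_id:
  assumes "\<rho> \<in> obj C"
  shows "\<epsilon> \<rho> (id_endo N) = id_blinfun" "\<epsilon> (id_endo N) \<rho> = id_blinfun"
  using assms braiding unfolding unitary_braiding_def by blast+

text \<open>Taking adjoints inverts the braiding unitaries. This turns naturality into naturality for the
  exchanged arguments, and interchanges the two hexagon identities.\<close>

lemma opposite_braiding: "unitary_braiding N C (\<lambda>\<rho> \<sigma>. adj (\<epsilon> \<sigma> \<rho>))"
proof -
  have arr: "\<forall>\<rho>\<in>obj C. \<forall>\<sigma>\<in>obj C. adj (\<epsilon> \<sigma> \<rho>) \<in> arr C (compose N \<rho> \<sigma>) (compose N \<sigma> \<rho>) \<and>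
      adj (adj (\<epsilon> \<sigma> \<rho>)) o\<^sub>L adj (\<epsilon> \<sigma> \<rho>) = id_blinfun \<and> adj (\<epsilon> \<sigma> \<rho>) o\<^sub>L adj (adj (\<epsilon> \<sigma> \<rho>)) = id_blinfun"
    by (simp add: arr_adj braiding_arr obj_compose adj_adj in_bounded braiding_in braiding_unitary)
  have nat: "adj (\<epsilon> \<sigma>' \<rho>') o\<^sub>L (s o\<^sub>L \<rho> t) = (t o\<^sub>L \<sigma> s) o\<^sub>L adj (\<epsilon> \<sigma> \<rho>)"
    if "\<rho> \<in> obj C" "\<rho>' \<in> obj C" "\<sigma> \<in> obj C" "\<sigma>' \<in> obj C" "s \<in> arr C \<rho> \<rho>'" "t \<in> arr C \<sigma> \<sigma>'"
    for \<rho> \<rho>' \<sigma> \<sigma>' s t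
  proof -
    have "adj (\<epsilon> \<sigma>' \<rho>') o\<^sub>L (s o\<^sub>L \<rho> t)
        = adj (\<epsilon> \<sigma>' \<rho>') o\<^sub>L ((s o\<^sub>L \<rho> t) o\<^sub>L \<epsilon> \<sigma> \<rho>) o\<^sub>L adj (\<epsilon> \<sigma> \<rho>)"
      by (simp add: oL_assoc braiding_unitary that)
    also have "\<dots> = (adj (\<epsilon> \<sigma>' \<rho>') o\<^sub>L \<epsilon> \<sigma>' \<rho>') o\<^sub>L (t o\<^sub>L \<sigma> s) o\<^sub>L adj (\<epsilon> \<sigma> \<rho>)"
      unfolding braiding_natural[OF that(3,4,1,2,6,5), symmetric] by (simp add: oL_assoc)
    finally show ?thesis by (simp add: braiding_unitary that)
  qed
  have hex: "adj (\<epsilon> \<tau> (compose N \<rho> \<sigma>)) = adj (\<epsilon> \<tau> \<rho>) o\<^sub>L \<rho> (adj (\<epsilon> \<tau> \<sigma>))"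
    "adj (\<epsilon> (compose N \<sigma> \<tau>) \<rho>) = \<sigma> (adj (\<epsilon> \<tau> \<rho>)) o\<^sub>L adj (\<epsilon> \<sigma> \<rho>)"
    if "\<rho> \<in> obj C" "\<sigma> \<in> obj C" "\<tau> \<in> obj C" for \<rho> \<sigma> \<tau>
    using that
    by (simp_all add: braiding_hexagon adj_oL in_bounded braiding_in End_in[OF obj_End] End_adj[OF obj_End])
  have unit: "\<forall>\<rho>\<in>obj C. adj (\<epsilon> (id_endo N) \<rho>) = id_blinfun \<and> adj (\<epsilon> \<rho> (id_endo N)) = id_blinfun"
    by (simp add: braiding_id)
  show ?thesis
    unfolding unitary_braiding_def arrow_tensor_def
  proof (intro conjI[OF arr] conjI[OF _ conjI[OF _ unit]] ballI)
    show "adj (\<epsilon> \<sigma>' \<rho>') o\<^sub>L (s o\<^sub>L \<rho> t) = (t o\<^sub>L \<sigma> s) o\<^sub>L adj (\<epsilon> \<sigma> \<rho>)"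
      if "\<rho> \<in> obj C" "\<rho>' \<in> obj C" "\<sigma> \<in> obj C" "\<sigma>' \<in> obj C" "s \<in> arr C \<rho> \<rho>'" "t \<in> arr C \<sigma> \<sigma>'"
      for \<rho> \<rho>' \<sigma> \<sigma>' s t
      by (rule nat[OF that])
  qed (simp_all add: hex End_id[OF obj_End] obj_compose)
qed

section \<open>The braided product\<close>

context
  fixes \<alpha> \<beta> :: "'h endo"
  assumes \<alpha>: "\<alpha> \<in> obj C" and \<beta>: "\<beta> \<in> obj C"
begin

private lemmas \<alpha>_End = obj_End[OF \<alpha>]
private lemmas \<beta>_End = obj_End[OF \<beta>]
private lemmas u_in = braiding_in[OF \<alpha> \<beta>]
private lemmas u_unitary = braiding_unitary[OF \<alpha> \<beta>]

text \<open>Tensoring \<open>adj wA\<close> with the identity of \<open>\<alpha>\<close> makes it an arrow $\alpha^2 \to \alpha$, which can be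
  composed with \<open>a\<close>. What matters is that \<open>adj wA o\<^sub>L a\<close> therefore commutes with $\alpha(\mathcal N)$.\<close>

lemma compressed_multiplication_arr:
  assumes wA: "wA \<in> arr C (id_endo N) \<alpha>" and a: "a \<in> arr C \<alpha> (compose N \<alpha> \<alpha>)"
  shows "adj wA o\<^sub>L a \<in> arr C \<alpha> \<alpha>"
proof -
  have "adj wA o\<^sub>L \<alpha> id_blinfun \<in> arr C (compose N \<alpha> \<alpha>) (compose N (id_endo N) \<alpha>)"
    using \<alpha> obj_id arr_adj[OF obj_id \<alpha> wA] by (intro arr_tensor) (auto intro: arr_id)
  then have "adj wA \<in> arr C (compose N \<alpha> \<alpha>) \<alpha>"
    by (simp add: End_id[OF \<alpha>_End] compose_id_endo[OF \<alpha>])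
  then show ?thesis using a by (intro arr_comp[OF \<alpha> obj_compose[OF \<alpha> \<alpha>] \<alpha>])
qed

text \<open>With $u = \varepsilon_{\alpha,\beta}$, the relation $w_A^*\,\alpha(u) = u\,w_A^*$ brings $u$ next to $w_B^*$,
  which absorbs it: naturality against the arrow $w_B^* : \beta \to \mathrm{id}$ gives
  $w_B^* u = \alpha(w_B^*)$.\<close>

lemma compress_braided_product:
  assumes wA: "wA \<in> arr C (id_endo N) \<alpha>" and wB: "wB \<in> arr C (id_endo N) \<beta>"
    and a: "a \<in> arr C \<alpha> (compose N \<alpha> \<alpha>)" and b: "b \<in> arr C \<beta> (compose N \<beta> \<beta>)"
  shows "adj (wA o\<^sub>L wB) o\<^sub>L braided_product \<epsilon> \<alpha> \<beta> a b = \<alpha> (adj wB o\<^sub>L b) o\<^sub>L (adj wA o\<^sub>L a)"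
proof -
  let ?u = "\<epsilon> \<alpha> \<beta>"
  have in_N: "wA \<in> N" "wB \<in> N" "b \<in> N"
    using arr_in[OF obj_id \<alpha> wA] arr_in[OF obj_id \<beta> wB] arr_in[OF \<beta> obj_compose[OF \<beta> \<beta>] b] .
  have wA_u: "adj wA o\<^sub>L \<alpha> ?u = ?u o\<^sub>L adj wA"
    using arr_intertwines[OF \<alpha> obj_id arr_adj[OF obj_id \<alpha> wA] u_in] u_in by (simp add: id_endo_def)
  have wB_u: "adj wB o\<^sub>L ?u = \<alpha> (adj wB)"
    using braiding_natural_right[OF \<alpha> \<beta> obj_id arr_adj[OF obj_id \<beta> wB]]
    by (simp add: braiding_id \<alpha>)
  have "adj (wA o\<^sub>L wB) o\<^sub>L \<alpha> ?u = adj wB o\<^sub>L (adj wA o\<^sub>L \<alpha> ?u)"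
    using in_N by (simp add: adj_oL in_bounded oL_assoc)
  also have "\<dots> = \<alpha> (adj wB) o\<^sub>L adj wA"
    unfolding wA_u wB_u[symmetric] by (simp add: oL_assoc)
  finally have W: "adj (wA o\<^sub>L wB) o\<^sub>L \<alpha> ?u = \<alpha> (adj wB) o\<^sub>L adj wA" .
  have "adj (wA o\<^sub>L wB) o\<^sub>L braided_product \<epsilon> \<alpha> \<beta> a b
      = (adj (wA o\<^sub>L wB) o\<^sub>L \<alpha> ?u) o\<^sub>L (a o\<^sub>L \<alpha> b)"
    by (simp add: braided_product_def oL_assoc)
  also have "\<dots> = \<alpha> (adj wB) o\<^sub>L ((adj wA o\<^sub>L a) o\<^sub>L \<alpha> b)"
    unfolding W by (simp add: oL_assoc)
  also have "(adj wA o\<^sub>L a) o\<^sub>L \<alpha> b = \<alpha> b o\<^sub>L (adj wA o\<^sub>L a)"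
    by (rule arr_intertwines[OF \<alpha> \<alpha> compressed_multiplication_arr[OF wA a] in_N(3)])
  also have "\<alpha> (adj wB) o\<^sub>L (\<alpha> b o\<^sub>L (adj wA o\<^sub>L a)) = \<alpha> (adj wB o\<^sub>L b) o\<^sub>L (adj wA o\<^sub>L a)"
    using in_N vN_adj[OF vN] by (simp add: End_oL[OF \<alpha>_End] oL_assoc)
  finally show ?thesis .
qed

text \<open>Conjugation by $u = \varepsilon_{\alpha,\beta}$ exchanges the roles of the two systems: on the right, \<open>b\<close> stands
  alone and \<open>a\<close> occurs only inside $\beta$. By the hexagon identities, naturality in the first
  argument reads $u\,\alpha(u)\,a = \beta(a)\,u$ and naturality in the second reads
  $\beta(u)\,u\,\alpha(b) = b\,u$.\<close>

lemma conjugate_braided_product: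
  assumes a: "a \<in> arr C \<alpha> (compose N \<alpha> \<alpha>)" and b: "b \<in> arr C \<beta> (compose N \<beta> \<beta>)"
  shows "\<epsilon> \<alpha> \<beta> o\<^sub>L braided_product \<epsilon> \<alpha> \<beta> a b o\<^sub>L adj (\<epsilon> \<alpha> \<beta>) = \<beta> a o\<^sub>L \<beta> (adj (\<epsilon> \<alpha> \<beta>)) o\<^sub>L b"
proof -
  let ?u = "\<epsilon> \<alpha> \<beta>"
  have ua: "?u o\<^sub>L \<alpha> ?u o\<^sub>L a = \<beta> a o\<^sub>L ?u"
    using braiding_natural_left[OF \<alpha> obj_compose[OF \<alpha> \<alpha>] \<beta> a] by (simp add: braiding_hexagon \<alpha> \<beta>)
  have ub: "\<beta> ?u o\<^sub>L ?u o\<^sub>L \<alpha> b = b o\<^sub>L ?u"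
    using braiding_natural_right[OF \<alpha> \<beta> obj_compose[OF \<beta> \<beta>] b] by (simp add: braiding_hexagon \<alpha> \<beta>)
  have "\<beta> (adj ?u) o\<^sub>L \<beta> ?u = id_blinfun"
    using u_unitary(1) u_in vN_adj[OF vN] by (simp add: End_id[OF \<beta>_End] flip: End_oL[OF \<beta>_End])
  then have "?u o\<^sub>L \<alpha> b = \<beta> (adj ?u) o\<^sub>L (\<beta> ?u o\<^sub>L ?u o\<^sub>L \<alpha> b)"
    by (simp flip: oL_assoc)
  also have "\<dots> = \<beta> (adj ?u) o\<^sub>L b o\<^sub>L ?u"
    unfolding ub by (simp add: oL_assoc)
  finally have ub': "?u o\<^sub>L \<alpha> b = \<beta> (adj ?u) o\<^sub>L b o\<^sub>L ?u" .
  have "?u o\<^sub>L braided_product \<epsilon> \<alpha> \<beta> a b = (?u o\<^sub>L \<alpha> ?u o\<^sub>L a) o\<^sub>L \<alpha> b"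
    by (simp add: braided_product_def oL_assoc)
  also have "\<dots> = \<beta> a o\<^sub>L (?u o\<^sub>L \<alpha> b)" unfolding ua by (simp add: oL_assoc)
  also have "\<dots> = \<beta> a o\<^sub>L \<beta> (adj ?u) o\<^sub>L b o\<^sub>L ?u" unfolding ub' by (simp add: oL_assoc)
  finally show ?thesis using u_unitary(2) by (simp add: oL_assoc)
qed

text \<open>Both given separating properties apply to the same \<open>n\<close>: to \<open>n\<close> itself in the algebra of the first
  system, and to its conjugate by $\varepsilon_{\alpha,\beta}$ in the algebra of the second. The second one is used first, to
  strip off \<open>wB\<close>.\<close>

lemma braided_product_separating:
  assumes wA: "wA \<in> arr C (id_endo N) \<alpha>" and wB: "wB \<in> arr C (id_endo N) \<beta>"
    and mA: "\<And>i. i \<in> I \<Longrightarrow> mA i \<in> arr C \<alpha> (compose N \<alpha> \<alpha>)"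
    and mB: "\<And>j. j \<in> J \<Longrightarrow> mB j \<in> arr C \<beta> (compose N \<beta> \<beta>)"
    and sepA: "\<And>n. n \<in> vN_generated (\<alpha> ` N \<union> mA ` I) \<Longrightarrow> n o\<^sub>L wA = 0 \<Longrightarrow> n = 0"
    and sepB: "\<And>n. n \<in> vN_generated (\<beta> ` N \<union> mB ` J) \<Longrightarrow> n o\<^sub>L wB = 0 \<Longrightarrow> n = 0"
    and n: "n \<in> vN_generated (compose N \<alpha> \<beta> ` N \<union>
              (\<lambda>(i, j). braided_product \<epsilon> \<alpha> \<beta> (mA i) (mB j)) ` (I \<times> J))"
    and zero: "n o\<^sub>L (wA o\<^sub>L wB) = 0"
  shows "n = 0"
proof -
  let ?u = "\<epsilon> \<alpha> \<beta>"
  let ?A = "vN_generated (\<alpha> ` N \<union> mA ` I)" and ?B = "vN_generated (\<beta> ` N \<union> mB ` J)"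
  let ?S = "compose N \<alpha> \<beta> ` N \<union> (\<lambda>(i, j). braided_product \<epsilon> \<alpha> \<beta> (mA i) (mB j)) ` (I \<times> J)"
  have mA_in: "mA i \<in> N" if "i \<in> I" for i
    using arr_in[OF \<alpha> obj_compose[OF \<alpha> \<alpha>] mA[OF that]] .
  have mB_in: "mB j \<in> N" if "j \<in> J" for j
    using arr_in[OF \<beta> obj_compose[OF \<beta> \<beta>] mB[OF that]] .
  have A: "von_neumann_algebra ?A"
    using mA_in by (intro von_neumann_algebra_generated[OF vN]) (auto intro: End_in[OF \<alpha>_End])
  have B: "von_neumann_algebra ?B"
    using mB_in by (intro von_neumann_algebra_generated[OF vN]) (auto intro: End_in[OF \<beta>_End])
  have A_end: "\<alpha> x \<in> ?A" if "x \<in> N" for x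
    using that by (intro vN_generated_in) simp
  have B_end: "\<beta> x \<in> ?B" if "x \<in> N" for x
    using that by (intro vN_generated_in) simp
  have A_m: "mA i \<in> ?A" if "i \<in> I" for i
    using that by (intro vN_generated_in) simp
  have B_m: "mB j \<in> ?B" if "j \<in> J" for j
    using that by (intro vN_generated_in) simp
  \<comment> \<open>The unitary \<open>u\<close> and the \<open>mB j\<close> lie in \<open>N\<close>, so that \<open>\<alpha>\<close> maps them into \<open>?A\<close>.\<close>
  have "?S \<subseteq> ?A"
    using A_end A_m mB_in u_in End_in[OF \<beta>_End]
    by (auto simp: compose_eq braided_product_def intro!: vN_oL[OF A])
  then have nA: "n \<in> ?A" using vN_generated_minimal[OF A] n by blast
  have conj: "von_neumann_algebra {n. ?u o\<^sub>L n o\<^sub>L adj ?u \<in> ?B}"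
    using u_unitary in_bounded[OF u_in] by (intro von_neumann_algebra_conjugate[OF B])
  have "?u o\<^sub>L \<alpha> (\<beta> x) o\<^sub>L adj ?u = \<beta> (\<alpha> x)" if "x \<in> N" for x
    using braiding_intertwines[OF \<alpha> \<beta> that] u_unitary(2) by (simp add: oL_assoc)
  moreover have "?u o\<^sub>L braided_product \<epsilon> \<alpha> \<beta> (mA i) (mB j) o\<^sub>L adj ?u \<in> ?B" if "i \<in> I" "j \<in> J" for i j
    using that mA_in u_in vN_adj[OF vN]
    by (auto simp: conjugate_braided_product[OF mA mB] intro!: vN_oL[OF B] B_end B_m)
  ultimately have "?S \<subseteq> {n. ?u o\<^sub>L n o\<^sub>L adj ?u \<in> ?B}"
    using B_end End_in[OF \<alpha>_End] by (auto simp: compose_eq)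
  then have nB: "?u o\<^sub>L n o\<^sub>L adj ?u \<in> ?B" using vN_generated_minimal[OF conj] n by blast
  \<comment> \<open>Naturality against the arrow \<open>wA : id \<rightarrow> \<alpha>\<close>, with trivial braiding at \<open>id\<close>.\<close>
  have u_wA: "?u o\<^sub>L wA = \<beta> wA"
    using braiding_natural_left[OF obj_id \<alpha> \<beta> wA] by (simp add: braiding_id \<beta>)
  have "adj ?u o\<^sub>L \<beta> wA = wA"
    unfolding u_wA[symmetric] using u_unitary(1) by (simp flip: oL_assoc)
  then have c: "(?u o\<^sub>L n o\<^sub>L adj ?u) o\<^sub>L \<beta> wA = ?u o\<^sub>L (n o\<^sub>L wA)"
    by (simp add: oL_assoc)
  have "(?u o\<^sub>L n o\<^sub>L adj ?u) o\<^sub>L \<beta> wA \<in> ?B"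
    by (rule vN_oL[OF B nB B_end[OF arr_in[OF obj_id \<alpha> wA]]])
  \<comment> \<open>Right multiplication by \<open>\<beta> wA\<close> keeps the element in \<open>?B\<close>, so \<open>wB\<close> can be cancelled.\<close>
  moreover have "((?u o\<^sub>L n o\<^sub>L adj ?u) o\<^sub>L \<beta> wA) o\<^sub>L wB = 0"
    unfolding c using zero by (simp add: oL_assoc)
  ultimately have "?u o\<^sub>L (n o\<^sub>L wA) = 0" unfolding c[symmetric] by (rule sepB)
  then have "(adj ?u o\<^sub>L ?u) o\<^sub>L (n o\<^sub>L wA) = 0" by (simp add: oL_assoc)
  then have "n o\<^sub>L wA = 0" by (simp add: u_unitary(1))
  with nA show "n = 0" by (rule sepA)
qed

text \<open>The braided product is $(1_\alpha \otimes \varepsilon_{\alpha,\beta} \otimes 1_\beta)(a \otimes b)$.\<close>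

lemma braided_product_arr:
  assumes a: "a \<in> arr C \<alpha> (compose N \<alpha> \<alpha>)" and b: "b \<in> arr C \<beta> (compose N \<beta> \<beta>)"
  shows "braided_product \<epsilon> \<alpha> \<beta> a b
      \<in> arr C (compose N \<alpha> \<beta>) (compose N (compose N \<alpha> \<beta>) (compose N \<alpha> \<beta>))"
proof -
  let ?u = "\<epsilon> \<alpha> \<beta>"
  note objs = \<alpha> \<beta> obj_compose[OF \<alpha> \<alpha>] obj_compose[OF \<beta> \<beta>] obj_compose[OF \<alpha> \<beta>] obj_compose[OF \<beta> \<alpha>]
  have "a o\<^sub>L \<alpha> b \<in> arr C (compose N \<alpha> \<beta>) (compose N (compose N \<alpha> \<alpha>) (compose N \<beta> \<beta>))"
    using objs a b by (intro arr_tensor)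
  moreover have "?u o\<^sub>L compose N \<alpha> \<beta> id_blinfun
      \<in> arr C (compose N (compose N \<alpha> \<beta>) \<beta>) (compose N (compose N \<beta> \<alpha>) \<beta>)"
    using objs by (intro arr_tensor) (auto intro: arr_id braiding_arr)
  then have "id_blinfun o\<^sub>L \<alpha> ?u \<in> arr C (compose N \<alpha> (compose N (compose N \<alpha> \<beta>) \<beta>))
      (compose N \<alpha> (compose N (compose N \<beta> \<alpha>) \<beta>))"
    using objs by (intro arr_tensor) (auto intro: arr_id obj_compose simp: End_id[OF obj_End])
  ultimately show ?thesis
    using arr_comp[of "compose N \<alpha> \<beta>" "compose N (compose N \<alpha> \<alpha>) (compose N \<beta> \<beta>)"
        "compose N (compose N \<alpha> \<beta>) (compose N \<alpha> \<beta>)" "a o\<^sub>L \<alpha> b" "\<alpha> ?u"] objs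
    by (simp add: braided_product_def oL_assoc compose_assoc_obj obj_compose)
qed

text \<open>With $a_i = w_A^* m^A_i$, $b_j = w_B^* m^B_j$, $p_i = a_i^* a_i$ and $q_j = b_j^* b_j$, the projection of the index $(i,j)$ is
  $a_i^*\,\alpha(q_j)\,a_i = \alpha(q_j)\,p_i$, because $a_i$ commutes with $\alpha(\mathcal N)$.\<close>

lemma braided_product_partition:
  assumes wA: "wA \<in> arr C (id_endo N) \<alpha>" and wB: "wB \<in> arr C (id_endo N) \<beta>"
    and mA: "\<And>i. i \<in> I \<Longrightarrow> mA i \<in> arr C \<alpha> (compose N \<alpha> \<alpha>)"
    and mB: "\<And>j. j \<in> J \<Longrightarrow> mB j \<in> arr C \<beta> (compose N \<beta> \<beta>)"
    and partA: "projection_partition (\<lambda>i. adj (mA i) o\<^sub>L wA o\<^sub>L adj wA o\<^sub>L mA i) I"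
    and partB: "projection_partition (\<lambda>j. adj (mB j) o\<^sub>L wB o\<^sub>L adj wB o\<^sub>L mB j) J"
  defines "M \<equiv> \<lambda>(i, j). braided_product \<epsilon> \<alpha> \<beta> (mA i) (mB j)"
  shows "projection_partition (\<lambda>k. adj (M k) o\<^sub>L (wA o\<^sub>L wB) o\<^sub>L adj (wA o\<^sub>L wB) o\<^sub>L M k) (I \<times> J)"
proof -
  define p where "p i = adj (mA i) o\<^sub>L wA o\<^sub>L adj wA o\<^sub>L mA i" for i
  define q where "q j = adj (mB j) o\<^sub>L wB o\<^sub>L adj wB o\<^sub>L mB j" for j
  define a where "a i = adj wA o\<^sub>L mA i" for i
  define b where "b j = adj wB o\<^sub>L mB j" for j
  have mA_in: "mA i \<in> N" if "i \<in> I" for i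
    using arr_in[OF \<alpha> obj_compose[OF \<alpha> \<alpha>] mA[OF that]] .
  have mB_in: "mB j \<in> N" if "j \<in> J" for j
    using arr_in[OF \<beta> obj_compose[OF \<beta> \<beta>] mB[OF that]] .
  have wA_in: "wA \<in> N" and wB_in: "wB \<in> N"
    using arr_in[OF obj_id \<alpha> wA] arr_in[OF obj_id \<beta> wB] .
  note closed = vN_oL[OF vN] vN_adj[OF vN]
  have p_eq: "p i = adj (a i) o\<^sub>L a i" if "i \<in> I" for i
    using that mA_in wA_in closed by (simp add: p_def a_def adj_oL adj_adj in_bounded oL_assoc)
  have q_eq: "q j = adj (b j) o\<^sub>L b j" if "j \<in> J" for j
    using that mB_in wB_in closed by (simp add: q_def b_def adj_oL adj_adj in_bounded oL_assoc)
  have b_in: "b j \<in> N" if "j \<in> J" for j using that mB_in wB_in closed by (simp add: b_def)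
  have q_in: "q j \<in> N" if "j \<in> J" for j using that b_in closed by (simp add: q_eq)
  have a_arr: "a i \<in> arr C \<alpha> \<alpha>" if "i \<in> I" for i
    unfolding a_def using wA mA[OF that] by (rule compressed_multiplication_arr)
  have a_in: "a i \<in> N" if "i \<in> I" for i using arr_in[OF \<alpha> \<alpha> a_arr[OF that]] .
  have p_comm: "p i o\<^sub>L \<alpha> x = \<alpha> x o\<^sub>L p i" if "i \<in> I" "x \<in> N" for i x
  proof -
    have "adj (a i) o\<^sub>L a i \<in> arr C \<alpha> \<alpha>"
      using that \<alpha> a_arr by (intro arr_comp[OF \<alpha> \<alpha> \<alpha>] arr_adj)
    then show ?thesis using arr_intertwines[OF \<alpha> \<alpha>] that by (simp add: p_eq)
  qed
  have M_eq: "adj (M (i, j)) o\<^sub>L (wA o\<^sub>L wB) o\<^sub>L adj (wA o\<^sub>L wB) o\<^sub>L M (i, j) = \<alpha> (q j) o\<^sub>L p i"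
    if ij: "i \<in> I" "j \<in> J" for i j
  proof -
    have V: "adj (wA o\<^sub>L wB) o\<^sub>L M (i, j) = \<alpha> (b j) o\<^sub>L a i"
      unfolding M_def a_def b_def using compress_braided_product[OF wA wB mA[OF ij(1)] mB[OF ij(2)]]
      by simp
    have "M (i, j) \<in> N"
      using ij mA_in mB_in u_in by (simp add: M_def braided_product_def closed End_in[OF \<alpha>_End])
    then have "adj (M (i, j)) o\<^sub>L (wA o\<^sub>L wB) = adj (adj (wA o\<^sub>L wB) o\<^sub>L M (i, j))"
      using wA_in wB_in closed by (simp add: adj_oL[of "adj (wA o\<^sub>L wB)"] adj_adj in_bounded)
    also have "\<dots> = adj (a i) o\<^sub>L \<alpha> (adj (b j))"
      unfolding V using ij a_in b_in
      by (simp add: adj_oL in_bounded End_in[OF \<alpha>_End] End_adj[OF \<alpha>_End])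
    finally have "adj (M (i, j)) o\<^sub>L (wA o\<^sub>L wB) o\<^sub>L (adj (wA o\<^sub>L wB) o\<^sub>L M (i, j))
        = adj (a i) o\<^sub>L (\<alpha> (adj (b j)) o\<^sub>L \<alpha> (b j)) o\<^sub>L a i"
      unfolding V by (simp add: oL_assoc)
    also have "\<alpha> (adj (b j)) o\<^sub>L \<alpha> (b j) = \<alpha> (q j)"
      using ij b_in closed by (simp add: q_eq End_oL[OF \<alpha>_End])
    also have "adj (a i) o\<^sub>L \<alpha> (q j) = \<alpha> (q j) o\<^sub>L adj (a i)"
      using arr_intertwines[OF \<alpha> \<alpha> arr_adj[OF \<alpha> \<alpha> a_arr]] ij q_in by simp
    finally show ?thesis using ij by (simp add: p_eq oL_assoc)
  qed
  have "projection_partition (\<lambda>j. \<alpha> (q j)) J"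
    using partB q_in by (intro End_projection_partition[OF vN \<alpha>_End]) (auto simp: q_def)
  with partA have "projection_partition (\<lambda>(i, j). \<alpha> (q j) o\<^sub>L p i) (I \<times> J)"
    unfolding p_def[symmetric] by (rule projection_partition_product) (simp_all add: p_comm q_in)
  moreover have "(case k of (i, j) \<Rightarrow> \<alpha> (q j) o\<^sub>L p i)
      = adj (M k) o\<^sub>L (wA o\<^sub>L wB) o\<^sub>L adj (wA o\<^sub>L wB) o\<^sub>L M k" if "k \<in> I \<times> J" for k
    using that by (auto simp: M_eq)
  ultimately show ?thesis
    unfolding projection_partition_def by (simp cong: has_sum_cong)
qed

end

end


lemma generalized_Q_system_iff:
  "generalized_Q_system N \<theta> w m I \<longleftrightarrow>
     \<theta> \<in> End N \<and> w \<in> Hom N (id_endo N) \<theta> \<and> adj w o\<^sub>L w = id_blinfun \<and> m ` I \<subseteq> N \<and>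
     projection_partition (\<lambda>i. adj (m i) o\<^sub>L w o\<^sub>L adj w o\<^sub>L m i) I \<and>
     (\<forall>n\<in>vN_generated (\<theta> ` N \<union> m ` I). n o\<^sub>L w = 0 \<longrightarrow> n = 0)"
  unfolding generalized_Q_system_def projection_partition_def Let_def by blast

theorem proposition4p2:
  fixes N :: "('h::chilbert_space \<Rightarrow>\<^sub>L 'h) set"
    and C :: "('h \<Rightarrow>\<^sub>L 'h) subcat"
    and \<epsilon> :: "'h endo \<Rightarrow> 'h endo \<Rightarrow> ('h \<Rightarrow>\<^sub>L 'h)"
    and \<theta>A \<theta>B :: "'h endo" and wA wB :: "'h \<Rightarrow>\<^sub>L 'h"
    and mA :: "'i \<Rightarrow> ('h \<Rightarrow>\<^sub>L 'h)" and I :: "'i set"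
    and mB :: "'j \<Rightarrow> ('h \<Rightarrow>\<^sub>L 'h)" and J :: "'j set"
    and sg :: braiding_sign
  assumes "von_neumann_algebra N" and "properly_infinite N"
    and "C_star_tensor_subcategory N C" and "unitary_braiding N C \<epsilon>"
    and "generalized_Q_system_of_intertwiners N \<theta>A wA mA I" and "Q_system_in N C \<theta>A wA mA I"
    and "generalized_Q_system_of_intertwiners N \<theta>B wB mB J" and "Q_system_in N C \<theta>B wB mB J"
  shows "generalized_Q_system_of_intertwiners N (compose N \<theta>A \<theta>B) (wA o\<^sub>L wB)
           (\<lambda>(i, j). braided_product (signed_braiding sg \<epsilon>) \<theta>A \<theta>B (mA i) (mB j)) (I \<times> J)
       \<and> Q_system_in N C (compose N \<theta>A \<theta>B) (wA o\<^sub>L wB)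
           (\<lambda>(i, j). braided_product (signed_braiding sg \<epsilon>) \<theta>A \<theta>B (mA i) (mB j)) (I \<times> J)"
proof -
  have braiding: "unitary_braiding N C (signed_braiding sg \<epsilon>)"
    using assms(1,3,4) braided_endomorphisms.opposite_braiding[of N C \<epsilon>]
    by (cases sg) (simp_all add: braided_endomorphisms_def)
  interpret braided_endomorphisms N C "signed_braiding sg \<epsilon>"
    using assms(1,3) braiding by unfold_locales
  define M where "M = (\<lambda>(i, j). braided_product (signed_braiding sg \<epsilon>) \<theta>A \<theta>B (mA i) (mB j))"
  let ?\<theta> = "compose N \<theta>A \<theta>B" and ?w = "wA o\<^sub>L wB"
  have \<theta>A: "\<theta>A \<in> obj C" and wA: "wA \<in> arr C (id_endo N) \<theta>A"
    and mA: "\<And>i. i \<in> I \<Longrightarrow> mA i \<in> arr C \<theta>A (compose N \<theta>A \<theta>A)"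
    using assms(6) by (auto simp: Q_system_in_def)
  have \<theta>B: "\<theta>B \<in> obj C" and wB: "wB \<in> arr C (id_endo N) \<theta>B"
    and mB: "\<And>j. j \<in> J \<Longrightarrow> mB j \<in> arr C \<theta>B (compose N \<theta>B \<theta>B)"
    using assms(8) by (auto simp: Q_system_in_def)
  note QA = assms(5)[unfolded generalized_Q_system_of_intertwiners_def generalized_Q_system_iff]
  note QB = assms(7)[unfolded generalized_Q_system_of_intertwiners_def generalized_Q_system_iff]
  note \<theta> = obj_compose[OF \<theta>A \<theta>B]
  have wA_in: "wA \<in> N" and wB_in: "wB \<in> N"
    using arr_in[OF obj_id \<theta>A wA] arr_in[OF obj_id \<theta>B wB] .
  have "wA o\<^sub>L id_endo N wB \<in> arr C (compose N (id_endo N) (id_endo N)) ?\<theta>"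
    by (rule arr_tensor[OF obj_id \<theta>A obj_id \<theta>B wA wB])
  then have w: "?w \<in> arr C (id_endo N) ?\<theta>"
    using wB_in by (simp add: compose_id_endo[OF obj_id]) (simp add: id_endo_def)
  have M: "M k \<in> arr C ?\<theta> (compose N ?\<theta> ?\<theta>)" if "k \<in> I \<times> J" for k
    using that braided_product_arr[OF \<theta>A \<theta>B mA mB] by (auto simp: M_def)
  have "Q_system_in N C ?\<theta> ?w M (I \<times> J)"
    using \<theta> w M by (simp add: Q_system_in_def)
  moreover have "adj ?w o\<^sub>L ?w = id_blinfun"
  proof -
    have "adj ?w o\<^sub>L ?w = adj wB o\<^sub>L (adj wA o\<^sub>L wA) o\<^sub>L wB"
      using wA_in wB_in by (simp add: adj_oL in_bounded oL_assoc)
    then show ?thesis using QA QB by simp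
  qed
  moreover have "projection_partition (\<lambda>k. adj (M k) o\<^sub>L ?w o\<^sub>L adj ?w o\<^sub>L M k) (I \<times> J)"
    unfolding M_def using QA QB by (intro braided_product_partition[OF \<theta>A \<theta>B wA wB mA mB]) auto
  moreover have "\<forall>n\<in>vN_generated (?\<theta> ` N \<union> M ` (I \<times> J)). n o\<^sub>L ?w = 0 \<longrightarrow> n = 0"
  proof (intro ballI impI)
    show "n = 0" if n: "n \<in> vN_generated (?\<theta> ` N \<union> M ` (I \<times> J))" "n o\<^sub>L ?w = 0" for n
      by (rule braided_product_separating[OF \<theta>A \<theta>B wA wB mA mB _ _ n[unfolded M_def]])
        (use QA QB in simp_all)
  qed
  ultimately have "generalized_Q_system N ?\<theta> ?w M (I \<times> J)"
    unfolding generalized_Q_system_iff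
    using obj_End[OF \<theta>] arr_Hom[OF obj_id \<theta> w] arr_in[OF \<theta> obj_compose[OF \<theta> \<theta>] M]
    by (intro conjI image_subsetI)
  then show ?thesis
    using \<open>Q_system_in N C ?\<theta> ?w M (I \<times> J)\<close> arr_Hom[OF \<theta> obj_compose[OF \<theta> \<theta>] M]
    unfolding generalized_Q_system_of_intertwiners_def M_def[symmetric] by (intro conjI ballI)
qed

end
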